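(* Let $\mathbb{G}=F_n\times\mathbb{Z}^m$. There exists an algorithm which, on input a finitely generated subgroup $\mathcal{H}\leqslant\mathbb{G}$ (given by a finite generating set) and an element $ut^{\mathbf{a}}\in\mathbb{G}$, outputs $\mathrm{Ord}_{\mathcal{H}}(ut^{\mathbf{a}})$. That is, the order problem for $\mathbb{G}$ is computable.
   Context: Elements of $F_n\times\mathbb{Z}^m$ are written $ut^{\mathbf{a}}$ with $u\in F_n$ and $\mathbf{a}\in\mathbb{Z}^m$. For $g\in\mathbb{G}$, $\mathrm{Ord}_{\mathcal{H}}(g)=\min\{k\geq1:g^k\in\mathcal{H}\}$ if such $k$ exists and $0$ otherwise. *)

theory Defs
  imports "HOL-Algebra.Generated_Groups" "HOL-Library.Nat_Bijection"
begin

datatype recf = Zero | SucF | Proj nat | Comp recf "recf list" | Pr recf recf | Mn recf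

inductive reval :: "recf \<Rightarrow> nat list \<Rightarrow> nat \<Rightarrow> bool" where
  zero: "reval Zero xs 0"
| suc: "reval SucF (x # xs) (Suc x)"
| proj: "i < length xs \<Longrightarrow> reval (Proj i) xs (xs ! i)"
| comp: "list_all2 (\<lambda>g y. reval g xs y) gs ys \<Longrightarrow> reval f ys z \<Longrightarrow> reval (Comp f gs) xs z"
| pr0: "reval f xs y \<Longrightarrow> reval (Pr f g) (0 # xs) y"
| prS: "reval (Pr f g) (k # xs) y \<Longrightarrow> reval g (k # y # xs) z \<Longrightarrow> reval (Pr f g) (Suc k # xs) z"
| mn: "reval f (k # xs) 0 \<Longrightarrow> (\<forall>i<k. \<exists>y. 0 < y \<and> reval f (i # xs) y) \<Longrightarrow> reval (Mn f) xs k"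

text \<open>A letter (i, b) is the generator x_i (b = False) or its inverse (b = True).
  Elements of F_n are freely reduced words; elements of Z^m are integer lists of length m.\<close>

type_synonym letter = "nat \<times> bool"

fun reduced :: "letter list \<Rightarrow> bool" where
  "reduced (x # y # w) = (\<not> (fst x = fst y \<and> snd x \<noteq> snd y) \<and> reduced (y # w))"
| "reduced _ = True"

fun push :: "letter \<Rightarrow> letter list \<Rightarrow> letter list" where
  "push x [] = [x]"
| "push x (y # ys) = (if fst x = fst y \<and> snd x \<noteq> snd y then ys else x # y # ys)"

definition fmult :: "letter list \<Rightarrow> letter list \<Rightarrow> letter list" where
  "fmult u v = foldr push u v"

definition FZ :: "nat \<Rightarrow> nat \<Rightarrow> (letter list \<times> int list) monoid" where
  "FZ n m = \<lparr> carrier = {(w, a). reduced w \<and> (\<forall>x\<in>set w. fst x < n) \<and> length a = m},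
             mult = (\<lambda>(u, a) (v, b). (fmult u v, map2 (+) a b)),
             one = ([], replicate m 0) \<rparr>"

definition Ord_in :: "('a, 'b) monoid_scheme \<Rightarrow> 'a set \<Rightarrow> 'a \<Rightarrow> nat" where
  "Ord_in G H g = (if \<exists>k::nat\<ge>1. g [^]\<^bsub>G\<^esub> k \<in> H then (LEAST k::nat. k \<ge> 1 \<and> g [^]\<^bsub>G\<^esub> k \<in> H) else 0)"

definition enc_letter :: "letter \<Rightarrow> nat" where
  "enc_letter x = 2 * fst x + (if snd x then 1 else 0)"

definition enc_elt :: "letter list \<times> int list \<Rightarrow> nat" where
  "enc_elt g = prod_encode (list_encode (map enc_letter (fst g)), list_encode (map int_encode (snd g)))"

definition enc_input :: "(letter list \<times> int list) list \<Rightarrow> letter list \<times> int list \<Rightarrow> nat" where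
  "enc_input S g = prod_encode (list_encode (map enc_elt S), enc_elt g)"

end

theory Submission
  imports Defs
begin

text \<open>
  An unbounded search over natural numbers computes the order once there are finite certificates,
  checkable by a recursive function, that are sound and exist for every input. Let \<open>H\<close> be the subgroup
  generated by \<open>S\<close> and let \<open>A\<close> be its projection to the free group. A finite piece of the coset graph of
  \<open>A\<close>, folded and with integer weights on its edges, lets $F_n \times Z^m$ act partially on pairs of a
  state and a residue modulo \<open>N\<close>; if the generators of \<open>H\<close> fix the base point, then so does \<open>H\<close>.

  If $u t^a$ is not in \<open>H\<close>, some such automaton shows it: the coset graph handles $u \notin A$, and
  otherwise a functional on $Z^m$ modulo some \<open>N\<close> separates a vector from the lattice of central
  elements of \<open>H\<close>. This certifies the minimality of a finite order. If no positive power of $u t^a$ is in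
  \<open>H\<close>, there are two cases. When $(u t^a)^p$ projects into \<open>A\<close> for some positive \<open>p\<close>, there is a functional
  with \<open>N = 0\<close> for which $(u t^a)^p$ moves the base point by a non-zero integer, hence so do all its
  powers. When no power of $u = c v c^{-1}$ (with \<open>v\<close> cyclically reduced) lies in \<open>A\<close>, the words
  $c v^j$ reach infinitely many cosets, so they eventually cannot be read in a finite automaton,
  whereas reduced words of \<open>A\<close> can.
\<close>

section \<open>Partial recursive functions\<close>

text \<open>No decision procedure for the subgroup is ever run, neither folding of graphs nor
  reduction of lattices. Only the check of a certificate has to be recursive; that certificates
  exist may be shown with choice, least elements and infinite coset spaces. The obstacle is infinite
  order, where one finite object must exclude infinitely many powers. Both ways of doing so rest on
  passing to further powers: if the i-th power lies in the subgroup, so does every multiple of it. A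
  non-zero integer drift stays non-zero under multiplication. For c v c^{-1}, the power with
  exponent i(j+1) has a reduced word that begins with c v^j. Weights are needed because
  \<open>H\<close> is in general not the product of its projection and its central part. A word of
  the projection is accompanied by certain vectors only, which differ by central vectors of
  \<open>H\<close>. An edge weight is minus the functional of such a vector, collected when a word
  is replaced by the representative of its coset, so weight plus functional vanishes on
  \<open>H\<close> modulo \<open>N\<close>. Moduli are unavoidable: over the integers alone no
  functional separates a vector from a lattice that contains a multiple of it.\<close>

definition recursive :: "nat \<Rightarrow> (nat list \<Rightarrow> nat) \<Rightarrow> bool" where
  "recursive k f = (\<exists>r. \<forall>xs. length xs = k \<longrightarrow> reval r xs (f xs))"

lemma recursive_cong:
  "recursive k f \<Longrightarrow> (\<And>xs. length xs = k \<Longrightarrow> f xs = g xs) \<Longrightarrow> recursive k g"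
  by (force simp: recursive_def)

lemma recursive_proj: "i < k \<Longrightarrow> recursive k (\<lambda>xs. xs ! i)"
  unfolding recursive_def by (metis reval.proj)

lemma recursive_compose:
  assumes f: "recursive (length gs) f" and gs: "\<forall>g\<in>set gs. recursive k g"
  shows "recursive k (\<lambda>xs. f (map (\<lambda>g. g xs) gs))"
proof -
  obtain rf where rf: "\<And>xs. length xs = length gs \<Longrightarrow> reval rf xs (f xs)"
    using f by (auto simp: recursive_def)
  obtain R where R: "\<And>g xs. g \<in> set gs \<Longrightarrow> length xs = k \<Longrightarrow> reval (R g) xs (g xs)"
    using gs bchoice[of "set gs" "\<lambda>g r. \<forall>xs. length xs = k \<longrightarrow> reval r xs (g xs)"]
    unfolding recursive_def by blast
  have "reval (Comp rf (map R gs)) xs (f (map (\<lambda>g. g xs) gs))" if "length xs = k" for xs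
    by (rule reval.comp[OF _ rf]) (auto simp: list_all2_conv_all_nth R that)
  then show ?thesis unfolding recursive_def by blast
qed

lemma recursive_compose1:
  assumes "recursive 1 (\<lambda>xs. f (xs ! 0))" "recursive k g"
  shows "recursive k (\<lambda>xs. f (g xs))"
  using recursive_compose[of "[g]" "\<lambda>xs. f (xs ! 0)" k] assms by simp

lemma recursive_compose2:
  assumes "recursive 2 (\<lambda>xs. f (xs ! 0) (xs ! 1))" "recursive k g" "recursive k h"
  shows "recursive k (\<lambda>xs. f (g xs) (h xs))"
  using recursive_compose[of "[g, h]" "\<lambda>xs. f (xs ! 0) (xs ! 1)" k] assms
  by (simp add: numeral_2_eq_2)

text \<open>In \<open>Pr\<close> the step function receives counter and accumulator in front of the
  parameters; a function of the parameters alone has to skip these two entries.\<close>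

lemma recursive_drop:
  assumes "recursive k f" shows "recursive (Suc (Suc k)) (\<lambda>xs. f (drop 2 xs))"
proof -
  let ?ps = "map (\<lambda>i (xs :: nat list). xs ! Suc (Suc i)) [0..<k]"
  have "recursive (Suc (Suc k)) (\<lambda>xs. f (map (\<lambda>g. g xs) ?ps))"
    by (rule recursive_compose) (use assms in \<open>auto intro: recursive_proj\<close>)
  then show ?thesis
  proof (rule recursive_cong)
    fix xs :: "nat list" assume "length xs = Suc (Suc k)"
    then have "map (\<lambda>g. g xs) ?ps = drop 2 xs" by (intro nth_equalityI) auto
    then show "f (map (\<lambda>g. g xs) ?ps) = f (drop 2 xs)" by (rule arg_cong)
  qed
qed

text \<open>\<open>Pr\<close> expects the counter at the head of the argument list, so the recursion
  is first realised on \<open>n # xs\<close> and then composed with \<open>c\<close> followed by all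
  projections.\<close>

lemma recursive_rec_nat:
  assumes c: "recursive k c" and i: "recursive k i"
    and g: "recursive (Suc (Suc k)) (\<lambda>xs. g (xs ! 0) (xs ! 1) (drop 2 xs))"
  shows "recursive k (\<lambda>xs. rec_nat (i xs) (\<lambda>j acc. g j acc xs) (c xs))"
proof -
  obtain ri where ri: "\<And>xs. length xs = k \<Longrightarrow> reval ri xs (i xs)"
    using i by (auto simp: recursive_def)
  obtain rg where rg: "\<And>xs. length xs = Suc (Suc k) \<Longrightarrow> reval rg xs (g (xs ! 0) (xs ! 1) (drop 2 xs))"
    using g by (auto simp: recursive_def)
  have "reval (Pr ri rg) (n # xs) (rec_nat (i xs) (\<lambda>j acc. g j acc xs) n)" if "length xs = k" for n xs
  proof (induction n)
    case 0 then show ?case by (auto intro: reval.pr0 ri that)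
  next
    case (Suc n)
    show ?case using reval.prS[OF Suc rg] that by simp
  qed
  then have "recursive (Suc k) (\<lambda>ys. rec_nat (i (tl ys)) (\<lambda>j acc. g j acc (tl ys)) (hd ys))"
    unfolding recursive_def by (intro exI[of _ "Pr ri rg"]) (auto simp: length_Suc_conv)
  then have "recursive k (\<lambda>xs. (\<lambda>ys. rec_nat (i (tl ys)) (\<lambda>j acc. g j acc (tl ys)) (hd ys))
      (map (\<lambda>g. g xs) (c # map (\<lambda>i xs. xs ! i) [0..<k])))"
    by (intro recursive_compose) (use c in \<open>auto intro: recursive_proj\<close>)
  then show ?thesis
  proof (rule recursive_cong, goal_cases)
    case (1 xs)
    have "map (\<lambda>g. g xs) (map (\<lambda>i xs. xs ! i) [0..<k]) = xs"
      using 1 by (intro nth_equalityI) auto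
    then show ?case by (simp only: list.map list.sel)
  qed
qed

lemma recursive_0: "recursive k (\<lambda>xs. 0)"
  unfolding recursive_def by (metis reval.zero)

lemma recursive_Suc: "recursive k f \<Longrightarrow> recursive k (\<lambda>xs. Suc (f xs))"
proof (rule recursive_compose1[where f = Suc])
  show "recursive 1 (\<lambda>xs. Suc (xs ! 0))"
    unfolding recursive_def by (auto simp: length_Suc_conv intro!: exI[of _ SucF] reval.suc)
qed

lemma recursive_const: "recursive k (\<lambda>xs. n)"
  by (induction n) (auto intro: recursive_0 recursive_Suc)

lemma recursive_add:
  assumes "recursive k f" "recursive k g" shows "recursive k (\<lambda>xs. f xs + g xs)"
proof (rule recursive_compose2[OF _ assms])
  have "recursive 2 (\<lambda>xs. rec_nat (xs ! 0) (\<lambda>j acc. Suc acc) (xs ! 1))"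
    by (intro recursive_rec_nat recursive_proj recursive_Suc) auto
  moreover have "rec_nat x (\<lambda>j acc. Suc acc) y = x + y" for x y by (induction y) auto
  ultimately show "recursive 2 (\<lambda>xs. xs ! 0 + xs ! 1)" by simp
qed

lemma recursive_mult:
  assumes "recursive k f" "recursive k g" shows "recursive k (\<lambda>xs. f xs * g xs)"
proof (rule recursive_compose2[OF _ assms])
  have "recursive 2 (\<lambda>xs. rec_nat 0 (\<lambda>j acc. acc + xs ! 0) (xs ! 1))"
    by (intro recursive_rec_nat recursive_proj recursive_0 recursive_add
        recursive_drop[where f = "\<lambda>xs. xs ! 0"]) auto
  moreover have "rec_nat 0 (\<lambda>j acc. acc + x) y = x * y" for x y :: nat by (induction y) auto
  ultimately show "recursive 2 (\<lambda>xs. xs ! 0 * xs ! 1)" by simp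
qed

lemma recursive_diff:
  assumes "recursive k f" "recursive k g" shows "recursive k (\<lambda>xs. f xs - g xs)"
proof (rule recursive_compose2[OF _ assms])
  have "recursive 1 (\<lambda>xs. rec_nat 0 (\<lambda>j acc. j) (xs ! 0))"
    by (intro recursive_rec_nat recursive_proj recursive_0) auto
  moreover have "rec_nat 0 (\<lambda>j acc. j) y = y - 1" for y :: nat by (cases y) auto
  ultimately have pred: "recursive 1 (\<lambda>xs. xs ! 0 - 1)" by simp
  have "recursive 2 (\<lambda>xs. rec_nat (xs ! 0) (\<lambda>j acc. acc - 1) (xs ! 1))"
    by (intro recursive_rec_nat recursive_proj recursive_compose1[OF pred]) auto
  moreover have "rec_nat x (\<lambda>j acc. acc - 1) y = x - y" for x y :: nat by (induction y) auto
  ultimately show "recursive 2 (\<lambda>xs. xs ! 0 - xs ! 1)" by simp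
qed

text \<open>A recursion whose step ignores the accumulator keeps its start value exactly when the
  count is 0.\<close>

lemma recursive_if_0:
  assumes "recursive k b" "recursive k f" "recursive k g"
  shows "recursive k (\<lambda>xs. if b xs = 0 then f xs else g xs)"
proof -
  have "recursive k (\<lambda>xs. rec_nat (f xs) (\<lambda>j acc. g xs) (b xs))"
    using assms by (intro recursive_rec_nat recursive_drop)
  moreover have "rec_nat x (\<lambda>j acc. y) n = (if n = 0 then x else y)" for x y n :: nat
    by (cases n) auto
  ultimately show ?thesis by simp
qed

section \<open>Cantor pairing and its inverse\<close>

lemma recursive_triangle: "recursive k f \<Longrightarrow> recursive k (\<lambda>xs. triangle (f xs))"
proof (rule recursive_compose1[where f = triangle])
  have "recursive 1 (\<lambda>xs. rec_nat 0 (\<lambda>j acc. acc + Suc j) (xs ! 0))"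
    by (intro recursive_rec_nat recursive_proj recursive_0 recursive_add recursive_Suc) auto
  moreover have "rec_nat 0 (\<lambda>j acc. acc + Suc j) n = triangle n" for n by (induction n) auto
  ultimately show "recursive 1 (\<lambda>xs. triangle (xs ! 0))" by simp
qed

lemma recursive_prod_encode:
  "recursive k f \<Longrightarrow> recursive k g \<Longrightarrow> recursive k (\<lambda>xs. prod_encode (f xs, g xs))"
  by (simp add: prod_encode_def) (intro recursive_add recursive_triangle)

text \<open>This is the index of the last triangular number not above the argument, updated as the
  argument grows by one; truncated subtraction serves as the comparison. At the Cantor code of
  \<open>(a, b)\<close> its value is \<open>a + b\<close>, which inverts the pairing.\<close>

definition triangle_root :: "nat \<Rightarrow> nat" where
  "triangle_root = rec_nat 0 (\<lambda>j s. if triangle (Suc s) - Suc j = 0 then Suc s else s)"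

lemma triangle_root:
  "triangle (triangle_root n) \<le> n \<and> n < triangle (Suc (triangle_root n))"
  by (induction n) (auto simp: triangle_root_def)

lemma triangle_mono: "m \<le> n \<Longrightarrow> triangle m \<le> triangle n"
  by (induction rule: dec_induct) auto

lemma triangle_root_unique:
  assumes "triangle s \<le> n" "n < triangle (Suc s)"
  shows "triangle_root n = s"
proof (rule ccontr)
  assume "triangle_root n \<noteq> s"
  then consider "Suc s \<le> triangle_root n" | "Suc (triangle_root n) \<le> s" by linarith
  then show False
  proof cases
    case 1
    then show ?thesis using assms triangle_root[of n] triangle_mono[OF 1] by linarith
  next
    case 2
    then show ?thesis using assms triangle_root[of n] triangle_mono[OF 2] by linarith
  qed
qed

lemma prod_decode_triangle_root:
  "prod_decode n = (n - triangle (triangle_root n), triangle_root n - (n - triangle (triangle_root n)))"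
proof -
  obtain a b where n: "n = prod_encode (a, b)" by (metis prod_decode_inverse surj_pair)
  have "triangle_root n = a + b"
    by (rule triangle_root_unique) (auto simp: n prod_encode_def)
  then show ?thesis by (simp add: n) (simp add: prod_encode_def)
qed

lemma recursive_triangle_root: "recursive k f \<Longrightarrow> recursive k (\<lambda>xs. triangle_root (f xs))"
proof (rule recursive_compose1[where f = triangle_root])
  show "recursive 1 (\<lambda>xs. triangle_root (xs ! 0))"
    unfolding triangle_root_def
    by (intro recursive_rec_nat recursive_proj recursive_0 recursive_if_0 recursive_Suc
      recursive_diff recursive_triangle) auto
qed

lemma recursive_prod_decode:
  assumes "recursive k f"
  shows "recursive k (\<lambda>xs. fst (prod_decode (f xs)))" "recursive k (\<lambda>xs. snd (prod_decode (f xs)))"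
  unfolding prod_decode_triangle_root fst_conv snd_conv
  by (intro recursive_diff recursive_triangle recursive_triangle_root assms)+

section \<open>Computable functions on coded data\<close>

text \<open>One argument suffices once tuples are numbers, and closure under composition becomes
  plain composition of functions.\<close>

definition code_computable :: "(nat \<Rightarrow> nat) \<Rightarrow> bool" where
  "code_computable F = recursive 1 (\<lambda>xs. F (xs ! 0))"

lemma code_computable_id: "code_computable (\<lambda>x. x)"
  unfolding code_computable_def by (rule recursive_proj) simp

lemma code_computable_compose:
  "code_computable F \<Longrightarrow> code_computable G \<Longrightarrow> code_computable (\<lambda>x. F (G x))"
  unfolding code_computable_def by (rule recursive_compose1)

lemma code_computable_const: "code_computable (\<lambda>x. n)"
  unfolding code_computable_def by (rule recursive_const)

lemma code_computable_arith:
  assumes "code_computable F"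
  shows code_computable_Suc: "code_computable (\<lambda>x. Suc (F x))"
    and code_computable_fst: "code_computable (\<lambda>x. fst (prod_decode (F x)))"
    and code_computable_snd: "code_computable (\<lambda>x. snd (prod_decode (F x)))"
    and code_computable_add: "code_computable G \<Longrightarrow> code_computable (\<lambda>x. F x + G x)"
    and code_computable_mult: "code_computable G \<Longrightarrow> code_computable (\<lambda>x. F x * G x)"
    and code_computable_diff: "code_computable G \<Longrightarrow> code_computable (\<lambda>x. F x - G x)"
    and code_computable_prod_encode:
      "code_computable G \<Longrightarrow> code_computable (\<lambda>x. prod_encode (F x, G x))"
    and code_computable_if_0: "code_computable B \<Longrightarrow> code_computable G \<Longrightarrow>
      code_computable (\<lambda>x. if B x = 0 then F x else G x)"
  using assms unfolding code_computable_def
  by (auto intro: recursive_Suc recursive_add recursive_mult recursive_diff recursive_if_0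
      recursive_prod_encode recursive_prod_decode)

lemma code_computable_rec_nat:
  assumes "code_computable C" "code_computable I" "code_computable G"
  shows "code_computable (\<lambda>x. rec_nat (I x) (\<lambda>j acc. G (prod_encode (x, prod_encode (j, acc)))) (C x))"
proof -
  have "recursive 1 (\<lambda>xs. rec_nat (I (xs ! 0))
      (\<lambda>j acc. G (prod_encode (xs ! 0, prod_encode (j, acc)))) (C (xs ! 0)))"
  proof (rule recursive_rec_nat)
    have "recursive (Suc (Suc 1)) (\<lambda>xs. prod_encode (drop 2 xs ! 0, prod_encode (xs ! 0, xs ! 1)))"
      by (intro recursive_prod_encode recursive_drop[where f = "\<lambda>xs. xs ! 0"] recursive_proj) auto
    then show "recursive (Suc (Suc 1))
        (\<lambda>xs. G (prod_encode (drop 2 xs ! 0, prod_encode (xs ! 0, xs ! 1))))"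
      using assms(3) unfolding code_computable_def by (rule recursive_compose1[rotated])
  qed (use assms in \<open>simp_all add: code_computable_def\<close>)
  then show ?thesis by (simp add: code_computable_def)
qed

text \<open>The parity flips at each step of a recursion, and \<open>n div 2\<close> counts the odd
  numbers below \<open>n\<close>.\<close>

lemma code_computable_parity:
  shows code_computable_mod2: "code_computable (\<lambda>x. x mod 2)"
    and code_computable_div2: "code_computable (\<lambda>x. x div 2)"
proof -
  let ?j = "\<lambda>z. fst (prod_decode (snd (prod_decode z)))"
    and ?acc = "\<lambda>z. snd (prod_decode (snd (prod_decode z)))"
  have "code_computable (\<lambda>x. rec_nat 0 (\<lambda>j acc. 1 - ?acc (prod_encode (x, prod_encode (j, acc)))) x)"
    by (rule code_computable_rec_nat[where G = "\<lambda>z. 1 - ?acc z"])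
      (intro code_computable_arith code_computable_id code_computable_const)+
  moreover have "rec_nat 0 (\<lambda>j acc. 1 - acc) n = n mod 2" for n :: nat
    by (induction n) (auto simp: mod_Suc)
  ultimately show mod: "code_computable (\<lambda>x. x mod 2)" by simp
  have "code_computable (\<lambda>x. rec_nat 0
      (\<lambda>j acc. (\<lambda>z. ?acc z + ?j z mod 2) (prod_encode (x, prod_encode (j, acc)))) x)"
    by (rule code_computable_rec_nat)
      (intro code_computable_arith code_computable_id code_computable_const
        code_computable_compose[OF mod])+
  moreover have "rec_nat 0 (\<lambda>j acc. acc + j mod 2) n = n div 2" for n :: nat
    by (induction n) (auto simp: div_Suc mod2_eq_if)
  ultimately show "code_computable (\<lambda>x. x div 2)" by simp
qed

lemma code_computable_funpow:
  assumes "code_computable C" "code_computable I" "code_computable G"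
  shows "code_computable (\<lambda>x. ((\<lambda>acc. G (prod_encode (x, acc))) ^^ C x) (I x))"
proof -
  let ?G = "\<lambda>z. G (prod_encode (fst (prod_decode z), snd (prod_decode (snd (prod_decode z)))))"
  have "code_computable ?G"
    by (intro code_computable_compose[OF assms(3)] code_computable_arith code_computable_id)
  from code_computable_rec_nat[OF assms(1,2) this]
  have "code_computable (\<lambda>x. rec_nat (I x) (\<lambda>j acc. G (prod_encode (x, acc))) (C x))"
    by simp
  moreover have "rec_nat i (\<lambda>j. g) n = (g ^^ n) i" for i n and g :: "nat \<Rightarrow> nat"
    by (induction n) auto
  ultimately show ?thesis by simp
qed

section \<open>Types with codes and computable functions between them\<close>

class encodable =
  fixes encode :: "'a \<Rightarrow> nat"
  assumes inj_encode: "inj encode"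

text \<open>An unbounded search runs through every natural number, so its search space needs a
  surjective coding. Injectivity suffices for all other data; \<open>bool\<close>, for instance,
  takes only the codes 0 and 1.\<close>

class bijectively_encodable = encodable +
  assumes surj_encode: "surj encode"

lemma encode_eq_iff [simp]: "encode x = encode y \<longleftrightarrow> x = y"
  using inj_encode by (auto dest: injD)

instantiation nat :: bijectively_encodable begin
definition "encode (n :: nat) = n"
instance by standard (auto simp: encode_nat_def inj_def surj_def)
end

instantiation int :: bijectively_encodable begin
definition "encode (n :: int) = int_encode n"
instance by standard (simp_all add: encode_int_def[abs_def] inj_int_encode surj_int_encode)
end

instantiation bool :: encodable begin
definition "encode (b :: bool) = (if b then 1 else 0 :: nat)"
instance by standard (auto simp: encode_bool_def inj_def split: if_splits)
end

instantiation prod :: (encodable, encodable) encodable begin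
definition "encode p = prod_encode (encode (fst p), encode (snd p))"
instance by standard (auto simp: encode_prod_def inj_def prod_eq_iff)
end

instance prod :: (bijectively_encodable, bijectively_encodable) bijectively_encodable
proof
  have "\<exists>p :: 'a \<times> 'b. z = encode p" for z
  proof -
    obtain a b where "fst (prod_decode z) = encode (a :: 'a)" "snd (prod_decode z) = encode (b :: 'b)"
      by (metis surj_encode surjD)
    then have "encode (a, b) = z" by (metis encode_prod_def fst_conv prod.collapse prod_decode_inverse snd_conv)
    then show ?thesis by metis
  qed
  then show "surj (encode :: 'a \<times> 'b \<Rightarrow> nat)" by (auto simp: surj_def)
qed

instantiation list :: (encodable) encodable begin
definition "encode xs = list_encode (map encode xs)"
instance by standard (auto simp: encode_list_def inj_def list_encode_eq inj_map_eq_map[OF inj_encode])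
end

instance list :: (bijectively_encodable) bijectively_encodable
proof
  have "\<exists>xs :: 'a list. z = encode xs" for z
  proof -
    have "map encode (map (inv_into UNIV encode :: nat \<Rightarrow> 'a) (list_decode z)) = list_decode z"
      by (simp add: map_idI surj_f_inv_f[OF surj_encode])
    then show ?thesis by (metis encode_list_def list_decode_inverse)
  qed
  then show "surj (encode :: 'a list \<Rightarrow> nat)" by (auto simp: surj_def)
qed

instantiation option :: (encodable) encodable begin
definition "encode x = (case x of None \<Rightarrow> 0 | Some a \<Rightarrow> Suc (encode a))"
instance by standard (auto simp: encode_option_def inj_def split: option.splits)
end

lemma encode_simps:
  "encode (a, b) = prod_encode (encode a, encode b)"
  "encode ([] :: 'a::encodable list) = 0"
  "encode (x # xs) = Suc (prod_encode (encode x, encode xs))"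
  "encode (None :: 'a option) = 0" "encode (Some x) = Suc (encode x)"
  by (simp_all add: encode_prod_def encode_list_def encode_option_def)

text \<open>This notion is closed under pairing, case distinction, iteration and folds, so that the
  computability of later definitions follows by introduction rules along their syntax.\<close>

definition computable :: "('a::encodable \<Rightarrow> 'b::encodable) \<Rightarrow> bool" where
  "computable f = (\<exists>F. code_computable F \<and> (\<forall>x. F (encode x) = encode (f x)))"

lemma computableI:
  "code_computable F \<Longrightarrow> (\<And>x. F (encode x) = encode (f x)) \<Longrightarrow> computable f"
  by (auto simp: computable_def)

lemma computable_id: "computable (\<lambda>x. x)"
  by (rule computableI[OF code_computable_id]) simp

lemma computable_const: "computable (\<lambda>x. c)"
  by (rule computableI[OF code_computable_const]) simp

lemma computable_compose:
  assumes "computable f" "computable g" shows "computable (\<lambda>x. f (g x))"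
proof -
  obtain F where F: "code_computable F" "\<And>x. F (encode x) = encode (f x)"
    using assms(1) unfolding computable_def by blast
  obtain G where G: "code_computable G" "\<And>x. G (encode x) = encode (g x)"
    using assms(2) unfolding computable_def by blast
  show ?thesis
    by (rule computableI[OF code_computable_compose[OF F(1) G(1)]]) (simp add: F G)
qed

lemma computable_lift1:
  assumes H: "\<And>F. code_computable F \<Longrightarrow> code_computable (\<lambda>x. H (F x))"
    and h: "\<And>a. H (encode a) = encode (h a)"
    and f: "computable f"
  shows "computable (\<lambda>x. h (f x))"
  by (rule computable_compose[OF computableI[OF H[OF code_computable_id] h] f])

lemma computable_lift2:
  assumes H: "\<And>F G. code_computable F \<Longrightarrow> code_computable G \<Longrightarrow> code_computable (\<lambda>x. H (F x) (G x))"
    and h: "\<And>a b. H (encode a) (encode b) = encode (h a b)"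
    and f: "computable f" and g: "computable g"
  shows "computable (\<lambda>x. h (f x) (g x))"
proof -
  obtain F where F: "code_computable F" "\<And>x. F (encode x) = encode (f x)"
    using f unfolding computable_def by blast
  obtain G where G: "code_computable G" "\<And>x. G (encode x) = encode (g x)"
    using g unfolding computable_def by blast
  show ?thesis
    by (rule computableI[OF H[OF F(1) G(1)]]) (simp add: F G h)
qed

lemma computable_Pair:
  "computable f \<Longrightarrow> computable g \<Longrightarrow> computable (\<lambda>x. (f x, g x))"
  by (rule computable_lift2[OF code_computable_prod_encode]) (auto simp: encode_simps)

lemma computable_fst: "computable f \<Longrightarrow> computable (\<lambda>x. fst (f x))"
  by (rule computable_lift1[OF code_computable_fst]) (auto simp: encode_prod_def)

lemma computable_snd: "computable f \<Longrightarrow> computable (\<lambda>x. snd (f x))"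
  by (rule computable_lift1[OF code_computable_snd]) (auto simp: encode_prod_def)

lemma computable_compose2:
  assumes "computable (\<lambda>p. f (fst p) (snd p))" "computable g" "computable h"
  shows "computable (\<lambda>x. f (g x) (h x))"
  using computable_compose[OF assms(1) computable_Pair[OF assms(2,3)]] by simp

lemma computable_compose3:
  assumes "computable (\<lambda>p. f (fst p) (fst (snd p)) (snd (snd p)))"
    "computable g" "computable h" "computable k"
  shows "computable (\<lambda>x. f (g x) (h x) (k x))"
  using computable_compose[OF assms(1) computable_Pair[OF assms(2) computable_Pair[OF assms(3,4)]]]
  by simp

lemma computable_Suc: "computable f \<Longrightarrow> computable (\<lambda>x. Suc (f x))"
  by (rule computable_lift1[OF code_computable_Suc]) (auto simp: encode_nat_def)

lemma computable_mod2: "computable f \<Longrightarrow> computable (\<lambda>x. (f x :: nat) mod 2)"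
  by (rule computable_lift1[OF code_computable_compose[OF code_computable_mod2]])
    (auto simp: encode_nat_def)

lemma computable_div2: "computable f \<Longrightarrow> computable (\<lambda>x. (f x :: nat) div 2)"
  by (rule computable_lift1[OF code_computable_compose[OF code_computable_div2]])
    (auto simp: encode_nat_def)

lemma computable_add_nat:
  "computable f \<Longrightarrow> computable g \<Longrightarrow> computable (\<lambda>x. f x + g x :: nat)"
  by (rule computable_lift2[OF code_computable_add]) (auto simp: encode_nat_def)

lemma computable_mult_nat:
  "computable f \<Longrightarrow> computable g \<Longrightarrow> computable (\<lambda>x. f x * g x :: nat)"
  by (rule computable_lift2[OF code_computable_mult]) (auto simp: encode_nat_def)

lemma computable_diff_nat:
  "computable f \<Longrightarrow> computable g \<Longrightarrow> computable (\<lambda>x. f x - g x :: nat)"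
  by (rule computable_lift2[OF code_computable_diff]) (auto simp: encode_nat_def)

lemma computable_if:
  assumes "computable b" "computable f" "computable g"
  shows "computable (\<lambda>x. if b x then f x else g x)"
proof -
  obtain B where B: "code_computable B" "\<And>x. B (encode x) = encode (b x)"
    using assms(1) unfolding computable_def by blast
  obtain F where F: "code_computable F" "\<And>x. F (encode x) = encode (f x)"
    using assms(2) unfolding computable_def by blast
  obtain G where G: "code_computable G" "\<And>x. G (encode x) = encode (g x)"
    using assms(3) unfolding computable_def by blast
  show ?thesis
    by (rule computableI[OF code_computable_if_0[OF G(1) B(1) F(1)]])
      (simp add: B F G encode_bool_def)
qed

text \<open>Injectivity of \<open>encode\<close> reduces equality to numbers, where it holds iff
  both truncated differences vanish.\<close>

lemma computable_eq:
  assumes "computable f" "computable g" shows "computable (\<lambda>x. f x = g x)"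
proof (rule computable_lift2[where H = "\<lambda>a b. 1 - ((a - b) + (b - a))" and h = "(=)", OF _ _ assms])
  show "code_computable (\<lambda>x. 1 - ((F x - G x) + (G x - F x)))"
    if "code_computable F" "code_computable G" for F G
    by (intro code_computable_arith code_computable_const that)
  show "1 - ((encode a - encode b) + (encode b - encode a)) = encode (a = b)" for a b :: 'b
    using encode_eq_iff[of a b] by (auto simp: encode_bool_def simp del: encode_eq_iff)
qed

lemma computable_not: "computable b \<Longrightarrow> computable (\<lambda>x. \<not> b x)"
  using computable_eq[of b "\<lambda>x. False"] by (simp add: computable_const)

lemma computable_conj: "computable b \<Longrightarrow> computable c \<Longrightarrow> computable (\<lambda>x. b x \<and> c x)"
  using computable_if[of b c "\<lambda>x. False"] by (simp add: computable_const if_bool_eq_conj conj_commute cong: conj_cong)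

lemma computable_disj: "computable b \<Longrightarrow> computable c \<Longrightarrow> computable (\<lambda>x. b x \<or> c x)"
  using computable_not[OF computable_conj[OF computable_not computable_not]] by fastforce

lemma computable_odd: "computable f \<Longrightarrow> computable (\<lambda>x. odd (f x :: nat))"
  unfolding odd_iff_mod_2_eq_one by (intro computable_eq computable_mod2 computable_const)

lemma computable_le:
  fixes f g :: "'a::encodable \<Rightarrow> nat"
  shows "computable f \<Longrightarrow> computable g \<Longrightarrow> computable (\<lambda>x. f x \<le> g x)"
  using computable_eq[OF computable_diff_nat[of f g] computable_const[of 0]] by simp

lemma computable_funpow:
  fixes i :: "'a::encodable \<Rightarrow> 'b::encodable" and s :: "'a \<Rightarrow> 'b \<Rightarrow> 'b"
  assumes "computable n" "computable i" "computable (\<lambda>p. s (fst p) (snd p))"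
  shows "computable (\<lambda>x. (s x ^^ n x) (i x))"
proof -
  obtain N where N: "code_computable N" "\<And>x. N (encode x) = encode (n x)"
    using assms(1) unfolding computable_def by blast
  obtain I where I: "code_computable I" "\<And>x. I (encode x) = encode (i x)"
    using assms(2) unfolding computable_def by blast
  obtain S where S: "code_computable S" "\<And>p. S (encode p) = encode (s (fst p) (snd p))"
    using assms(3) unfolding computable_def by blast
  show ?thesis
  proof (rule computableI[OF code_computable_funpow[OF N(1) I(1) S(1)]])
    fix x
    have "((\<lambda>acc. S (prod_encode (encode x, acc))) ^^ k) (encode (i x)) = encode ((s x ^^ k) (i x))" for k
    proof (induction k)
      case (Suc k)
      then show ?case using S(2)[of "(x, (s x ^^ k) (i x))"] by (simp add: encode_simps)
    qed simp
    then show "((\<lambda>acc. S (prod_encode (encode x, acc))) ^^ N (encode x)) (I (encode x))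
        = encode ((s x ^^ n x) (i x))"
      by (simp add: N I encode_nat_def)
  qed
qed

text \<open>The code 0 is reserved for \<open>None\<close>; otherwise the predecessor of the code is
  the code of the content.\<close>

lemma computable_case_option:
  assumes "computable h" "computable f" "computable (\<lambda>p. g (fst p) (snd p))"
  shows "computable (\<lambda>x. case h x of None \<Rightarrow> f x | Some a \<Rightarrow> g x a)"
proof -
  obtain H where H: "code_computable H" "\<And>x. H (encode x) = encode (h x)"
    using assms(1) unfolding computable_def by blast
  obtain F where F: "code_computable F" "\<And>x. F (encode x) = encode (f x)"
    using assms(2) unfolding computable_def by blast
  obtain G where G: "code_computable G" "\<And>p. G (encode p) = encode (g (fst p) (snd p))"
    using assms(3) unfolding computable_def by blast
  have "code_computable (\<lambda>z. if H z = 0 then F z else G (prod_encode (z, H z - 1)))"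
    by (intro code_computable_arith code_computable_const code_computable_id
        code_computable_compose[OF G(1)] H F)
  then show ?thesis
    by (rule computableI)
      (auto simp: H F G(2)[of "(a, b)" for a b, unfolded encode_simps fst_conv snd_conv] encode_simps
        split: option.split)
qed

lemma computable_Some: "computable f \<Longrightarrow> computable (\<lambda>x. Some (f x))"
  by (rule computable_lift1[OF code_computable_Suc]) (auto simp: encode_simps)

lemma computable_Cons: "computable f \<Longrightarrow> computable g \<Longrightarrow> computable (\<lambda>x. f x # g x)"
  by (rule computable_lift2[OF code_computable_Suc[OF code_computable_prod_encode]])
    (auto simp: encode_simps)

lemma computable_encode: "computable f \<Longrightarrow> computable (\<lambda>x. encode (f x))"
  by (rule computable_lift1[where H = "\<lambda>x. x"]) (auto simp: encode_nat_def)

lemma computable_case_list: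
  assumes "computable h" "computable f" "computable (\<lambda>p. g (fst p) (fst (snd p)) (snd (snd p)))"
  shows "computable (\<lambda>x. case h x of [] \<Rightarrow> f x | a # as \<Rightarrow> g x a as)"
proof -
  obtain H where H: "code_computable H" "\<And>x. H (encode x) = encode (h x)"
    using assms(1) unfolding computable_def by blast
  obtain F where F: "code_computable F" "\<And>x. F (encode x) = encode (f x)"
    using assms(2) unfolding computable_def by blast
  obtain G where G: "code_computable G" "\<And>p. G (encode p) = encode (g (fst p) (fst (snd p)) (snd (snd p)))"
    using assms(3) unfolding computable_def by blast
  have "code_computable (\<lambda>z. if H z = 0 then F z else G (prod_encode (z, H z - 1)))"
    by (intro code_computable_arith code_computable_const code_computable_id
        code_computable_compose[OF G(1)] H F)
  then show ?thesis
    by (rule computableI)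
      (auto simp: H F G(2)[of "(a, b, c)" for a b c, unfolded encode_simps fst_conv snd_conv]
        encode_simps split: list.split)
qed

text \<open>The code of a list can therefore serve as the number of iterations when the list is
  traversed.\<close>

lemma length_le_list_encode: "length xs \<le> list_encode xs"
  by (induction xs) (auto intro: order_trans[OF _ le_prod_encode_2])

lemma computable_foldl:
  fixes l :: "'a::encodable \<Rightarrow> 'c::encodable list" and i :: "'a \<Rightarrow> 'b::encodable"
  assumes l: "computable l" and i: "computable i"
    and s: "computable (\<lambda>p. s (fst p) (fst (snd p)) (snd (snd p)))"
  shows "computable (\<lambda>x. foldl (s x) (i x) (l x))"
proof -
  \<comment> \<open>The state holds the remaining list and the accumulator. It no longer changes
    once the list is empty, so iterating more often than the length is harmless.\<close>
  define t where "t x st = (case fst st of [] \<Rightarrow> st | a # as \<Rightarrow> (as, s x (snd st) a))"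
    for x and st :: "'c list \<times> 'b"
  have "computable (\<lambda>p. t (fst p) (snd p))"
    unfolding t_def
    by (rule computable_case_list) (intro computable_fst computable_snd computable_id
        computable_Pair computable_compose3[OF s])+
  then have "computable (\<lambda>x. snd ((t x ^^ encode (l x)) (l x, i x)))"
    by (intro computable_snd computable_funpow computable_Pair computable_encode l i)
  moreover have "snd ((t x ^^ n) (as, acc)) = foldl (s x) acc as" if "length as \<le> n" for x n as acc
    using that
  proof (induction n arbitrary: as acc)
    case (Suc n)
    show ?case
    proof (cases as)
      case Nil
      then have "(t x ^^ m) (as, acc) = (as, acc)" for m by (induction m) (auto simp: t_def)
      from this[of "Suc n"] show ?thesis using Nil by (simp del: funpow.simps)
    next
      case (Cons a as')
      then show ?thesis using Suc by (simp add: funpow_Suc_right t_def del: funpow.simps)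
    qed
  qed simp
  ultimately show ?thesis
    using length_le_list_encode[of "map encode (l x)" for x]
    by (simp add: encode_list_def)
qed

lemmas computable_basic =
  computable_Pair computable_fst computable_snd computable_Suc computable_add_nat computable_mult_nat
  computable_diff_nat computable_mod2 computable_div2 computable_if computable_eq computable_not
  computable_conj computable_disj computable_odd computable_le computable_case_option computable_Some
  computable_Cons computable_case_list computable_foldl computable_funpow computable_const computable_id

lemma computable_rev: "computable f \<Longrightarrow> computable (\<lambda>x. rev (f x))"
proof (rule computable_compose[where f = rev])
  have "computable (\<lambda>xs :: 'b list. foldl (\<lambda>acc a. a # acc) [] xs)"
    by (intro computable_basic)
  moreover have "foldl (\<lambda>acc a. a # acc) ys xs = rev xs @ ys" for xs ys :: "'b list"
    by (induction xs arbitrary: ys) auto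
  ultimately show "computable (rev :: 'b list \<Rightarrow> 'b list)" by simp
qed

lemma computable_append:
  assumes "computable f" "computable g" shows "computable (\<lambda>x. f x @ g x)"
proof -
  have "computable (\<lambda>x. foldl (\<lambda>acc a. a # acc) (g x) (rev (f x)))"
    by (intro computable_basic computable_rev assms)
  moreover have "foldl (\<lambda>acc a. a # acc) ys (rev xs) = xs @ ys" for xs ys :: "'b list"
    by (induction xs arbitrary: ys) auto
  ultimately show ?thesis by simp
qed

lemma computable_map:
  assumes "computable (\<lambda>p. h (fst p) (snd p))" "computable f"
  shows "computable (\<lambda>x. map (h x) (f x))"
proof -
  have "computable (\<lambda>x. rev (foldl (\<lambda>acc a. h x a # acc) [] (f x)))"
    by (intro computable_basic computable_rev computable_compose2[OF assms(1)] assms(2))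
  moreover have "foldl (\<lambda>acc a. h x a # acc) ys xs = rev (map (h x) xs) @ ys" for x xs ys
    by (induction xs arbitrary: ys) auto
  ultimately show ?thesis by simp
qed

lemma computable_ball:
  assumes "computable (\<lambda>p. h (fst p) (snd p))" "computable f"
  shows "computable (\<lambda>x. \<forall>a\<in>set (f x). h x a)"
proof -
  have "computable (\<lambda>x. foldl (\<lambda>acc a. acc \<and> h x a) True (f x))"
    by (intro computable_basic computable_compose2[OF assms(1)] assms(2))
  moreover have "foldl (\<lambda>acc a. acc \<and> h x a) b xs \<longleftrightarrow> b \<and> (\<forall>a\<in>set xs. h x a)" for x xs b
    by (induction xs arbitrary: b) auto
  ultimately show ?thesis by simp
qed

lemma computable_member:
  assumes "computable f" "computable g" shows "computable (\<lambda>x. f x \<in> set (g x))"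
proof -
  have "computable (\<lambda>x. \<not> (\<forall>a\<in>set (g x). \<not> (\<lambda>x a. f x = a) x a))"
    by (intro computable_not computable_ball computable_eq computable_snd computable_id
      computable_compose[OF assms(1)] computable_fst assms(2))
  moreover have "(\<not> (\<forall>a\<in>set xs. \<not> y = a)) = (y \<in> set xs)" for y and xs :: "'b list" by auto
  ultimately show ?thesis by simp
qed

lemma computable_length: "computable f \<Longrightarrow> computable (\<lambda>x. length (f x))"
proof (rule computable_compose[where f = length])
  have "computable (\<lambda>xs :: 'b list. foldl (\<lambda>acc a. Suc acc) 0 xs)"
    by (intro computable_basic)
  moreover have "foldl (\<lambda>acc a. Suc acc) n xs = n + length xs" for xs :: "'b list" and n
    by (induction xs arbitrary: n) auto
  ultimately show "computable (length :: 'b list \<Rightarrow> nat)" by simp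
qed

lemma computable_zip:
  fixes f :: "'a::encodable \<Rightarrow> 'b::encodable list" and g :: "'a \<Rightarrow> 'c::encodable list"
  assumes "computable f" "computable g" shows "computable (\<lambda>x. zip (f x) (g x))"
proof -
  let ?s = "\<lambda>st a. case fst st of [] \<Rightarrow> ([], snd st) | b # bs \<Rightarrow> (bs, (a, b) # snd st)"
  have "computable (\<lambda>x. rev (snd (foldl ?s (g x, []) (f x))))"
    by (intro computable_basic computable_rev assms)
  moreover have "snd (foldl ?s (ys, acc) xs) = rev (zip xs ys) @ acc"
    for xs :: "'b list" and ys :: "'c list" and acc
    by (induction xs arbitrary: ys acc) (auto split: list.split)
  ultimately show ?thesis by simp
qed

text \<open>Integer operations are computed on differences of natural numbers.\<close>

lemma computable_int_diff:
  assumes "computable f" "computable g" shows "computable (\<lambda>x. int (f x) - int (g x))"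
proof (rule computable_lift2[where h = "\<lambda>a b. int a - int b"
      and H = "\<lambda>a b. if b - a = 0 then 2 * (a - b) else 2 * (b - a) - 1", OF _ _ assms])
  show "code_computable (\<lambda>x. if G x - F x = 0 then 2 * (F x - G x) else 2 * (G x - F x) - 1)"
    if "code_computable F" "code_computable G" for F G
    by (intro code_computable_arith code_computable_const that)
qed (auto simp: encode_int_def encode_nat_def int_encode_def sum_encode_def nat_diff_distrib')

lemma computable_nat_parts:
  assumes "computable (f :: _ \<Rightarrow> int)"
  shows "computable (\<lambda>x. nat (f x))" "computable (\<lambda>x. nat (- f x))"
proof -
  have c: "computable (\<lambda>x. int_encode (f x))"
    using computable_encode[OF assms] by (simp add: encode_int_def)
  have "computable (\<lambda>x. if odd (int_encode (f x)) then 0 else int_encode (f x) div 2)"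
    by (intro computable_basic c)
  moreover have "(if odd (int_encode i) then 0 else int_encode i div 2) = nat i" for i
    by (auto simp: int_encode_def sum_encode_def)
  ultimately show "computable (\<lambda>x. nat (f x))" by simp
  have "computable (\<lambda>x. if odd (int_encode (f x)) then Suc (int_encode (f x) div 2) else 0)"
    by (intro computable_basic c)
  moreover have "(if odd (int_encode i) then Suc (int_encode i div 2) else 0) = nat (- i)" for i
    by (auto simp: int_encode_def sum_encode_def)
  ultimately show "computable (\<lambda>x. nat (- f x))" by simp
qed

lemma computable_add_int:
  fixes f g :: "'a::encodable \<Rightarrow> int"
  assumes "computable f" "computable g" shows "computable (\<lambda>x. f x + g x)"
proof -
  have "computable (\<lambda>x. int (nat (f x) + nat (g x)) - int (nat (- f x) + nat (- g x)))"
    by (intro computable_basic computable_int_diff computable_nat_parts assms)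
  moreover have "int (nat a + nat b) - int (nat (- a) + nat (- b)) = a + b" for a b by auto
  ultimately show ?thesis by simp
qed

lemma computable_minus_int:
  fixes f :: "'a::encodable \<Rightarrow> int"
  assumes "computable f" shows "computable (\<lambda>x. - f x)"
proof -
  have "computable (\<lambda>x. int (nat (- f x)) - int (nat (f x)))"
    by (intro computable_basic computable_int_diff computable_nat_parts assms)
  moreover have "int (nat (- a)) - int (nat a) = - a" for a by auto
  ultimately show ?thesis by simp
qed

lemma computable_mult_int:
  fixes f g :: "'a::encodable \<Rightarrow> int"
  assumes "computable f" "computable g" shows "computable (\<lambda>x. f x * g x)"
proof -
  have "computable (\<lambda>x. int (nat (f x) * nat (g x) + nat (- f x) * nat (- g x))
      - int (nat (f x) * nat (- g x) + nat (- f x) * nat (g x)))"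
    by (intro computable_basic computable_int_diff computable_nat_parts assms)
  moreover have "int (nat a * nat b + nat (- a) * nat (- b)) - int (nat a * nat (- b) + nat (- a) * nat b) = a * b" for a b
    by (cases "0 \<le> a"; cases "0 \<le> b") auto
  ultimately show ?thesis by simp
qed

lemma computable_dvd_int:
  assumes "computable f" "computable g" shows "computable (\<lambda>x. int (f x) dvd g x)"
proof -
  \<comment> \<open>A cyclic counter of residues. If \<open>f x = 0\<close>, the test never succeeds
    and the counter reaches the absolute value of \<open>g x\<close>, in agreement with
    \<open>k mod 0 = k\<close>; divisibility by 0 thus means being 0.\<close>
  let ?s = "\<lambda>x r. if Suc r = f x then 0 else Suc r"
  have "computable (\<lambda>x. (?s x ^^ (nat (g x) + nat (- g x))) 0 = 0)"
    by (intro computable_basic computable_nat_parts assms computable_compose[OF assms(1)])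
  moreover have "((\<lambda>r. if Suc r = n then 0 else Suc r) ^^ k) 0 = k mod n" for k n :: nat
    by (induction k) (auto simp: mod_Suc)
  moreover have "(nat b + nat (- b)) mod n = 0 \<longleftrightarrow> int n dvd b" for b n
  proof -
    have "int (nat b + nat (- b)) = \<bar>b\<bar>" by auto
    then have "int n dvd b \<longleftrightarrow> int n dvd int (nat b + nat (- b))" by simp
    then show ?thesis by (simp only: int_dvd_int_iff mod_eq_0_iff_dvd)
  qed
  ultimately show ?thesis by simp
qed

lemmas computable_intros = computable_basic computable_append computable_rev computable_map
  computable_ball computable_member computable_length computable_zip computable_add_int
  computable_minus_int computable_mult_int computable_dvd_int

text \<open>\<open>Mn\<close> demands positive values at all smaller arguments, and minimality
  provides them.\<close>

lemma recursive_Least: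
  assumes F: "code_computable F"
  shows "\<exists>r. \<forall>x. (\<exists>k. F (prod_encode (x, k)) = 0) \<longrightarrow>
    reval r [x] (LEAST k. F (prod_encode (x, k)) = 0)"
proof -
  have "recursive 2 (\<lambda>xs. F (prod_encode (xs ! 1, xs ! 0)))"
    by (rule recursive_compose1[OF F[unfolded code_computable_def]])
      (intro recursive_prod_encode recursive_proj; simp)
  then obtain r where "\<And>xs. length xs = 2 \<Longrightarrow> reval r xs (F (prod_encode (xs ! 1, xs ! 0)))"
    unfolding recursive_def by blast
  from this[of "[k, x]" for k x] have r: "reval r [k, x] (F (prod_encode (x, k)))" for k x by simp
  have "reval (Mn r) [x] (LEAST k. F (prod_encode (x, k)) = 0)"
    if "\<exists>k. F (prod_encode (x, k)) = 0" for x
  proof (rule reval.mn)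
    have "F (prod_encode (x, LEAST k. F (prod_encode (x, k)) = 0)) = 0"
      using that by (rule LeastI_ex)
    then show "reval r [LEAST k. F (prod_encode (x, k)) = 0, x] 0"
      using r[of "LEAST k. F (prod_encode (x, k)) = 0" x] by simp
    have "0 < F (prod_encode (x, i))" if "i < (LEAST k. F (prod_encode (x, k)) = 0)" for i
      using not_less_Least[OF that] by simp
    then show "\<forall>i<(LEAST k. F (prod_encode (x, k)) = 0). \<exists>y>0. reval r [i, x] y"
      using r by blast
  qed
  then show ?thesis by blast
qed

text \<open>The search finds the least code satisfying \<open>P\<close>, and surjectivity makes it
  the code of some \<open>c\<close>. Which \<open>c\<close> this is remains open; that suffices when
  all accepted ones have the same output.\<close>

lemma computable_search:
  fixes P :: "'a::encodable \<Rightarrow> 'c::bijectively_encodable \<Rightarrow> bool" and out :: "'c \<Rightarrow> nat"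
  assumes P: "computable (\<lambda>p. P (fst p) (snd p))" and out: "computable out"
  shows "\<exists>r. \<forall>x. (\<exists>c. P x c) \<longrightarrow> (\<exists>c. P x c \<and> reval r [encode x] (out c))"
proof -
  obtain F where F: "code_computable F" "\<And>p. F (encode p) = encode (\<not> P (fst p) (snd p))"
    using computable_not[OF P] unfolding computable_def by blast
  obtain G where G: "code_computable G" "\<And>c. G (encode c) = out c"
    using out unfolding computable_def encode_nat_def by blast
  obtain r where r: "\<And>x. \<exists>k. F (prod_encode (x, k)) = 0 \<Longrightarrow>
      reval r [x] (LEAST k. F (prod_encode (x, k)) = 0)"
    using recursive_Least[OF F(1)] by blast
  obtain q where q: "\<And>x. reval q [x] (G x)"
  proof -
    obtain q where q: "\<And>xs. length xs = 1 \<Longrightarrow> reval q xs (G (xs ! 0))"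
      using G(1) unfolding code_computable_def recursive_def by blast
    show ?thesis by (rule that[of q]) (use q[of "[x]" for x] in simp)
  qed
  have F0: "F (prod_encode (encode x, encode c)) = 0 \<longleftrightarrow> P x c" for x c
    using F(2)[of "(x, c)"] by (simp add: encode_simps encode_bool_def)
  have "\<exists>c. P x c \<and> reval (Comp q [r]) [encode x] (out c)" if ex: "\<exists>c. P x c" for x
  proof -
    let ?k = "LEAST k. F (prod_encode (encode x, k)) = 0"
    obtain c where c: "?k = encode (c :: 'c)" by (metis surj_encode surjD)
    have ex': "\<exists>k. F (prod_encode (encode x, k)) = 0" using ex F0 by blast
    then have "P x c" using LeastI_ex[OF ex'] F0 c by metis
    moreover have "reval (Comp q [r]) [encode x] (G ?k)"
      by (rule reval.comp[where ys = "[?k]"]) (simp_all add: r[OF ex'] q)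
    ultimately show ?thesis using c G(2) by metis
  qed
  then show ?thesis by blast
qed

section \<open>The group $F_n \times Z^m$\<close>

definition flip :: "letter \<Rightarrow> letter" where
  "flip x = (fst x, \<not> snd x)"

definition inv_word :: "letter list \<Rightarrow> letter list" where
  "inv_word w = rev (map flip w)"

lemma flip_flip [simp]: "flip (flip x) = x"
  by (simp add: flip_def)

lemma fst_flip [simp]: "fst (flip x) = fst x"
  by (simp add: flip_def)

lemma flip_eq_iff: "y = flip x \<longleftrightarrow> fst x = fst y \<and> snd x \<noteq> snd y"
  by (auto simp: flip_def prod_eq_iff)

declare push.simps [simp del]

lemma push_Nil [simp]: "push x [] = [x]"
  and push_Cons: "push x (y # w) = (if y = flip x then w else x # y # w)"
  and push_flip [simp]: "push x (flip x # w) = w"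
  by (simp_all add: push.simps flip_eq_iff) (simp add: flip_def)

lemma reduced_Cons: "reduced (x # w) \<longleftrightarrow> reduced w \<and> (w = [] \<or> hd w \<noteq> flip x)"
  by (cases w) (auto simp: flip_eq_iff)

lemma reduced_append_iff:
  "reduced (u @ v) \<longleftrightarrow> reduced u \<and> reduced v \<and> (u = [] \<or> v = [] \<or> hd v \<noteq> flip (last u))"
  by (induction u) (auto simp: reduced_Cons)

lemma reduced_push: "reduced w \<Longrightarrow> reduced (push x w)"
  by (cases w) (auto simp: push_Cons reduced_Cons)

text \<open>Each letter acts on the reduced words as a permutation whose inverse is the action of
  the flipped letter. This is van der Waerden's approach to free groups, and associativity of
  \<open>fmult\<close> comes from it.\<close>

lemma push_push_flip: "reduced w \<Longrightarrow> push x (push (flip x) w) = w"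
  by (cases w; cases "tl w") (auto simp: push_Cons reduced_Cons)

lemma fmult_Nil [simp]: "fmult [] v = v"
  and fmult_Cons: "fmult (x # u) v = push x (fmult u v)"
  and fmult_append: "fmult (u @ u') v = fmult u (fmult u' v)"
  by (simp_all add: fmult_def)

lemma reduced_fmult: "reduced v \<Longrightarrow> reduced (fmult u v)"
  by (induction u) (auto simp: fmult_Cons reduced_push)

text \<open>If \<open>push\<close> cancels a pair on the left, the same pair cancels on the right by
  \<open>push_push_flip\<close>.\<close>

lemma fmult_push: "reduced w \<Longrightarrow> fmult (push x u) w = push x (fmult u w)"
proof (cases u)
  case (Cons y u')
  assume "reduced w"
  then show ?thesis
    using push_push_flip[OF reduced_fmult, of w x u'] by (simp add: Cons push_Cons fmult_Cons)
qed (simp add: fmult_Cons)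

lemma fmult_assoc: "reduced w \<Longrightarrow> fmult (fmult u v) w = fmult u (fmult v w)"
  by (induction u) (auto simp: fmult_Cons fmult_push)

lemma fmult_eq_append: "reduced (u @ v) \<Longrightarrow> fmult u v = u @ v"
proof (induction u)
  case (Cons x u)
  then show ?case by (cases "u @ v") (auto simp: fmult_Cons push_Cons reduced_Cons)
qed simp

lemma fmult_Nil2 [simp]: "reduced u \<Longrightarrow> fmult u [] = u"
  using fmult_eq_append[of u "[]"] by simp

lemma inv_word_Nil [simp]: "inv_word [] = []"
  and inv_word_Cons: "inv_word (x # u) = inv_word u @ [flip x]"
  and inv_word_append: "inv_word (u @ v) = inv_word v @ inv_word u"
  and inv_word_inv_word [simp]: "inv_word (inv_word u) = u"
  by (simp_all add: inv_word_def rev_map o_def)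

lemma fst_set_inv_word: "fst ` set (inv_word u) = fst ` set u"
  by (auto simp: inv_word_def image_image)

lemma reduced_inv_word: "reduced u \<Longrightarrow> reduced (inv_word u)"
proof (induction u)
  case (Cons x u)
  then show ?case
    by (auto simp: inv_word_Cons reduced_append_iff reduced_Cons)
      (auto simp: inv_word_def last_rev hd_map)
qed simp

lemma fmult_inv_word_left: "reduced v \<Longrightarrow> fmult (inv_word u) (fmult u v) = v"
proof (induction u)
  case (Cons x u)
  then show ?case
    using push_push_flip[of "fmult u v" "flip x"]
    by (simp add: inv_word_Cons fmult_append fmult_Cons reduced_fmult)
qed simp

lemma fmult_inv_word_right: "reduced v \<Longrightarrow> fmult u (fmult (inv_word u) v) = v"
  using fmult_inv_word_left[of v "inv_word u"] by simp

lemma set_push: "set (push x w) \<subseteq> insert x (set w)"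
  by (cases w) (auto simp: push_Cons)

lemma set_fmult: "set (fmult u v) \<subseteq> set u \<union> set v"
proof (induction u)
  case (Cons x u)
  then show ?case using set_push[of x "fmult u v"] by (auto simp: fmult_Cons)
qed simp

definition words :: "nat \<Rightarrow> letter list set" where
  "words n = {w. reduced w \<and> (\<forall>x\<in>set w. fst x < n)}"

lemma words_Nil [simp]: "[] \<in> words n"
  by (simp add: words_def)

lemma words_reduced: "w \<in> words n \<Longrightarrow> reduced w"
  by (simp add: words_def)

lemma words_fmult: "u \<in> words n \<Longrightarrow> v \<in> words n \<Longrightarrow> fmult u v \<in> words n"
  using set_fmult[of u v] by (auto simp: words_def reduced_fmult)

lemma words_inv_word: "u \<in> words n \<Longrightarrow> inv_word u \<in> words n"
  using fst_set_inv_word[of u] by (force simp: words_def reduced_inv_word)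

lemma words_appendD: "u @ v \<in> words n \<Longrightarrow> u \<in> words n" "u @ v \<in> words n \<Longrightarrow> v \<in> words n"
  by (auto simp: words_def reduced_append_iff)

section \<open>The direct product and its generated subgroups\<close>

definition elt_mult :: "letter list \<times> int list \<Rightarrow> letter list \<times> int list \<Rightarrow> letter list \<times> int list" where
  "elt_mult g h = (fmult (fst g) (fst h), map2 (+) (snd g) (snd h))"

definition elt_inv :: "letter list \<times> int list \<Rightarrow> letter list \<times> int list" where
  "elt_inv g = (inv_word (fst g), map uminus (snd g))"

text \<open>Powers are written as an iteration so that \<open>computable_funpow\<close> applies;
  \<open>m\<close> supplies the length of the zero vector.\<close>

definition elt_pow :: "nat \<Rightarrow> letter list \<times> int list \<Rightarrow> nat \<Rightarrow> letter list \<times> int list" where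
  "elt_pow m g k = ((\<lambda>h. elt_mult h g) ^^ k) ([], replicate m 0)"

lemma elt_inv_elt_inv [simp]: "elt_inv (elt_inv g) = g"
  by (simp add: elt_inv_def o_def)

lemma carrier_FZ: "carrier (FZ n m) = {g. fst g \<in> words n \<and> length (snd g) = m}"
  by (auto simp: FZ_def words_def)

lemma mult_FZ: "g \<otimes>\<^bsub>FZ n m\<^esub> h = elt_mult g h"
  by (simp add: FZ_def elt_mult_def split: prod.split)

lemma one_FZ: "\<one>\<^bsub>FZ n m\<^esub> = ([], replicate m 0)"
  by (simp add: FZ_def)

lemma elt_inv_carrier: "g \<in> carrier (FZ n m) \<Longrightarrow> elt_inv g \<in> carrier (FZ n m)"
  by (simp add: carrier_FZ elt_inv_def words_inv_word)

lemma map2_add_assoc: "map2 (+) (map2 (+) a b) c = map2 (+) a (map2 (+) b (c :: int list))"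
  by (rule nth_equalityI) (auto simp: add.assoc)

lemma map2_uminus_left: "map2 (+) (map uminus a) a = replicate (length a) (0 :: int)"
  by (induction a) auto

lemma map2_replicate_0_left: "map2 (+) (replicate (length a) 0) a = (a :: int list)"
  by (induction a) auto

lemma elt_inv_mult:
  assumes "g \<in> carrier (FZ n m)"
  shows "elt_mult (elt_inv g) g = ([], replicate m 0)"
proof -
  have "fmult (inv_word (fst g)) (fst g) = []"
    using assms fmult_inv_word_left[of "[]" "fst g"] words_reduced[of "fst g" n]
    by (simp add: carrier_FZ)
  then show ?thesis
    using assms by (auto simp: carrier_FZ elt_inv_def elt_mult_def map2_uminus_left)
qed

lemma group_FZ: "group (FZ n m)"
proof (rule groupI)
  fix x assume x: "x \<in> carrier (FZ n m)"
  then show "\<exists>y\<in>carrier (FZ n m). y \<otimes>\<^bsub>FZ n m\<^esub> x = \<one>\<^bsub>FZ n m\<^esub>"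
    by (intro bexI[of _ "elt_inv x"]) (simp_all add: elt_inv_mult elt_inv_carrier mult_FZ one_FZ)
  show "\<one>\<^bsub>FZ n m\<^esub> \<otimes>\<^bsub>FZ n m\<^esub> x = x"
    using x map2_replicate_0_left[of "snd x"] by (auto simp: mult_FZ one_FZ elt_mult_def carrier_FZ)
  fix y assume y: "y \<in> carrier (FZ n m)"
  show "x \<otimes>\<^bsub>FZ n m\<^esub> y \<in> carrier (FZ n m)"
    using x y by (simp add: mult_FZ elt_mult_def carrier_FZ words_fmult)
  fix z assume "z \<in> carrier (FZ n m)"
  then show "x \<otimes>\<^bsub>FZ n m\<^esub> y \<otimes>\<^bsub>FZ n m\<^esub> z = x \<otimes>\<^bsub>FZ n m\<^esub> (y \<otimes>\<^bsub>FZ n m\<^esub> z)"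
    using words_reduced[of "fst z" n]
    by (simp add: mult_FZ elt_mult_def carrier_FZ fmult_assoc map2_add_assoc)
qed (simp add: one_FZ carrier_FZ)

lemma inv_FZ: "g \<in> carrier (FZ n m) \<Longrightarrow> inv\<^bsub>FZ n m\<^esub> g = elt_inv g"
  by (rule group.inv_equality[OF group_FZ])
    (simp_all add: elt_inv_mult elt_inv_carrier mult_FZ one_FZ)

lemma pow_FZ: "g [^]\<^bsub>FZ n m\<^esub> (k :: nat) = elt_pow m g k"
  by (induction k) (auto simp: elt_pow_def nat_pow_def mult_FZ one_FZ)

lemma subgroup_FZ_D:
  assumes "subgroup H (FZ n m)"
  shows "(w, a) \<in> H \<Longrightarrow> w \<in> words n" "(w, a) \<in> H \<Longrightarrow> length a = m"
    and "([], replicate m 0) \<in> H"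
    and "(w, a) \<in> H \<Longrightarrow> (v, b) \<in> H \<Longrightarrow> (fmult w v, map2 (+) a b) \<in> H"
    and "(w, a) \<in> H \<Longrightarrow> (inv_word w, map uminus a) \<in> H"
proof -
  interpret subgroup H "FZ n m" by fact
  show *: "(w, a) \<in> H \<Longrightarrow> w \<in> words n" "(w, a) \<in> H \<Longrightarrow> length a = m"
    using mem_carrier[of "(w, a)"] by (auto simp: carrier_FZ)
  show "([], replicate m 0) \<in> H" using one_closed by (simp add: one_FZ)
  show "(w, a) \<in> H \<Longrightarrow> (v, b) \<in> H \<Longrightarrow> (fmult w v, map2 (+) a b) \<in> H"
    using m_closed[of "(w, a)" "(v, b)"] by (simp add: mult_FZ elt_mult_def)
  show "(w, a) \<in> H \<Longrightarrow> (inv_word w, map uminus a) \<in> H"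
    using m_inv_closed[of "(w, a)"] mem_carrier[of "(w, a)"] by (simp add: inv_FZ elt_inv_def)
qed

text \<open>This makes membership verifiable: a witness is a finite list of generators and inverses
  of generators, whose product is evaluated by a fold.\<close>

lemma generate_iff_product:
  assumes "set S \<subseteq> carrier (FZ n m)"
  shows "h \<in> generate (FZ n m) (set S) \<longleftrightarrow>
    (\<exists>T. (\<forall>t\<in>set T. t \<in> set S \<or> elt_inv t \<in> set S) \<and> h = foldl elt_mult ([], replicate m 0) T)"
    (is "_ \<longleftrightarrow> ?R h")
proof
  interpret group "FZ n m" by (rule group_FZ)
  let ?ok = "\<lambda>T. \<forall>t\<in>set T. t \<in> set S \<or> elt_inv t \<in> set S"
  have gen: "t \<in> generate (FZ n m) (set S)" if "t \<in> set S \<or> elt_inv t \<in> set S" for t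
  proof (cases "t \<in> set S")
    case False
    with that have "elt_inv t \<in> set S" by simp
    then have "inv\<^bsub>FZ n m\<^esub> (elt_inv t) \<in> generate (FZ n m) (set S)" by (rule generate.inv)
    moreover have "elt_inv t \<in> carrier (FZ n m)" using assms \<open>elt_inv t \<in> set S\<close> by blast
    ultimately show ?thesis using inv_FZ[of "elt_inv t" n m] by simp
  qed (simp add: generate.incl)
  have fold: "x \<in> generate (FZ n m) (set S) \<Longrightarrow> ?ok T \<Longrightarrow>
      foldl elt_mult x T \<in> generate (FZ n m) (set S)" for x T
  proof (induction T arbitrary: x)
    case (Cons t T)
    then have "elt_mult x t \<in> generate (FZ n m) (set S)"
      using generate.eng[of x "FZ n m" "set S" t] gen[of t] by (simp add: mult_FZ)
    then show ?case using Cons by simp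
  qed simp
  show "?R h \<Longrightarrow> h \<in> generate (FZ n m) (set S)"
    using fold generate.one[of "FZ n m" "set S"] by (auto simp: one_FZ)
  have ok_carrier: "set T \<subseteq> carrier (FZ n m)" if "?ok T" for T
  proof
    fix t assume "t \<in> set T"
    then have "t \<in> carrier (FZ n m) \<or> elt_inv t \<in> carrier (FZ n m)" using that assms by blast
    then show "t \<in> carrier (FZ n m)" using elt_inv_carrier[of "elt_inv t" n m] by auto
  qed
  \<comment> \<open>\<open>foldl\<close> brackets to the left, so pulling out its initial value
    takes associativity. Concatenating lists then corresponds to multiplying their products.\<close>
  have shift: "foldl elt_mult x T = elt_mult x (foldl elt_mult ([], replicate m 0) T)"
    if "set T \<subseteq> carrier (FZ n m)" "x \<in> carrier (FZ n m)" for x T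
    using that
  proof (induction T rule: rev_induct)
    case Nil
    then show ?case using r_one[of x] by (simp add: mult_FZ one_FZ)
  next
    case (snoc t T)
    have "foldl elt_mult y T \<in> carrier (FZ n m)" if "y \<in> carrier (FZ n m)" for y
      using that snoc.prems(1)
      by (induction T arbitrary: y) (use m_closed in \<open>auto simp: mult_FZ\<close>)
    then show ?case
      using snoc m_assoc[of x "foldl elt_mult ([], replicate m 0) T" t]
      by (simp add: mult_FZ one_closed[unfolded one_FZ])
  qed
  assume "h \<in> generate (FZ n m) (set S)"
  then show "?R h"
  proof induction
    case one
    then show ?case by (intro exI[of _ "[]"]) (simp add: one_FZ)
  next
    case (incl h)
    then show ?case using l_one[of h] assms by (intro exI[of _ "[h]"]) (auto simp: mult_FZ one_FZ)
  next
    case (inv h)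
    then have "h \<in> carrier (FZ n m)" using assms by blast
    then show ?case
      using l_one[of "elt_inv h"] inv
      by (intro exI[of _ "[elt_inv h]"]) (auto simp: mult_FZ one_FZ inv_FZ elt_inv_carrier)
  next
    case (eng x y)
    then obtain T U where T: "?ok T" "x = foldl elt_mult ([], replicate m 0) T"
      and U: "?ok U" "y = foldl elt_mult ([], replicate m 0) U" by blast
    have "x \<in> carrier (FZ n m)" using eng.hyps(1) generate_in_carrier[OF assms] by blast
    then have "elt_mult x y = foldl elt_mult ([], replicate m 0) (T @ U)"
      using shift[OF ok_carrier[OF U(1)]] T U by simp
    then show ?case using T U by (intro exI[of _ "T @ U"]) (auto simp: mult_FZ)
  qed
qed

section \<open>Weighted inverse automata\<close>

text \<open>An edge \<open>(x, i, y, c)\<close> leads from state \<open>x\<close> to state \<open>y\<close>, is labelled with the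
  generator \<open>x_i\<close> and has weight \<open>c\<close>. It is traversed backwards, with the opposite weight, by
  the inverse letter.\<close>

type_synonym edge = "nat \<times> nat \<times> nat \<times> int"

definition edge_step :: "nat \<Rightarrow> letter \<Rightarrow> (nat \<times> int) option \<Rightarrow> edge \<Rightarrow> (nat \<times> int) option" where
  "edge_step x l acc e =
    (if fst (snd e) = fst l \<and> x = (if snd l then fst (snd (snd e)) else fst e)
     then Some (if snd l then (fst e, - snd (snd (snd e))) else snd (snd e))
     else acc)"

text \<open>The last matching edge of the list wins; in an \<open>inverse_automaton\<close> all
  matching edges agree in the state reached and in weight.\<close>

definition lookup :: "edge list \<Rightarrow> nat \<Rightarrow> letter \<Rightarrow> (nat \<times> int) option" where
  "lookup E x l = foldl (edge_step x l) None E"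

definition run_step :: "edge list \<Rightarrow> (nat \<times> int) option \<Rightarrow> letter \<Rightarrow> (nat \<times> int) option" where
  "run_step E st l = (case st of None \<Rightarrow> None | Some p \<Rightarrow>
     (case lookup E (fst p) l of None \<Rightarrow> None | Some q \<Rightarrow> Some (fst q, snd p + snd q)))"

definition run :: "edge list \<Rightarrow> nat \<Rightarrow> letter list \<Rightarrow> (nat \<times> int) option" where
  "run E x w = foldl (run_step E) (Some (x, 0)) w"

text \<open>In a folded graph label and either end determine the edge. Recovering each edge by
  \<open>lookup\<close> from both ends expresses this, weights included, by a bounded check.\<close>

definition inverse_automaton :: "edge list \<Rightarrow> bool" where
  "inverse_automaton E = (\<forall>e\<in>set E.
     lookup E (fst e) (fst (snd e), False) = Some (snd (snd e)) \<and>
     lookup E (fst (snd (snd e))) (fst (snd e), True) = Some (fst e, - snd (snd (snd e))))"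

lemma lookup_snoc: "lookup (E @ [e]) x l = edge_step x l (lookup E x l) e"
  by (simp add: lookup_def)

lemma lookup_False_Some: "lookup E x (i, False) = Some (y, c) \<Longrightarrow> (x, i, y, c) \<in> set E"
  by (induction E rule: rev_induct)
    (auto simp: lookup_snoc edge_step_def lookup_def[of "[]"] split: if_splits)

lemma lookup_True_Some: "lookup E y (i, True) = Some (x, c) \<Longrightarrow> (x, i, y, - c) \<in> set E"
  by (induction E rule: rev_induct)
    (auto simp: lookup_snoc edge_step_def lookup_def[of "[]"] split: if_splits)

lemma lookup_not_None:
  "(x, i, y, c) \<in> set E \<Longrightarrow> lookup E x (i, False) \<noteq> None \<and> lookup E y (i, True) \<noteq> None"
  by (induction E rule: rev_induct) (auto simp: lookup_snoc edge_step_def)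

lemma inverse_automatonI:
  assumes "\<And>x i y c y' c'. (x, i, y, c) \<in> set E \<Longrightarrow> (x, i, y', c') \<in> set E \<Longrightarrow> y = y' \<and> c = c'"
    and "\<And>x i y c x' c'. (x, i, y, c) \<in> set E \<Longrightarrow> (x', i, y, c') \<in> set E \<Longrightarrow> x = x' \<and> c = c'"
  shows "inverse_automaton E"
  unfolding inverse_automaton_def
proof safe
  fix x i y c assume e: "(x, i, y, c) \<in> set E"
  obtain y' c' where "lookup E x (i, False) = Some (y', c')"
    using lookup_not_None[OF e] by auto
  then show "lookup E (fst (x, i, y, c)) (fst (snd (x, i, y, c)), False) = Some (snd (snd (x, i, y, c)))"
    using assms(1)[OF e lookup_False_Some] by simp
  obtain x' c' where "lookup E y (i, True) = Some (x', c')"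
    using lookup_not_None[OF e] by auto
  then show "lookup E (fst (snd (snd (x, i, y, c)))) (fst (snd (x, i, y, c)), True)
      = Some (fst (x, i, y, c), - snd (snd (snd (x, i, y, c))))"
    using assms(2)[OF e lookup_True_Some] by simp
qed

lemma lookup_flip:
  assumes "inverse_automaton E" "lookup E x l = Some (y, c)"
  shows "lookup E y (flip l) = Some (x, - c)"
proof (cases "snd l")
  case True
  then have "(y, fst l, x, - c) \<in> set E" using assms(2) lookup_True_Some[of E x "fst l"] by (cases l) auto
  then have "lookup E y (fst l, False) = Some (x, - c)"
    using assms(1) by (auto simp: inverse_automaton_def dest!: bspec)
  then show ?thesis using True by (simp add: flip_def)
next
  case False
  then have "(x, fst l, y, c) \<in> set E" using assms(2) lookup_False_Some[of E x "fst l"] by (cases l) auto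
  then have "lookup E y (fst l, True) = Some (x, - c)"
    using assms(1) by (auto simp: inverse_automaton_def dest!: bspec)
  then show ?thesis using False by (simp add: flip_def)
qed

lemma run_Nil [simp]: "run E x [] = Some (x, 0)"
  by (simp add: run_def)

lemma foldl_run_step_None: "foldl (run_step E) None w = None"
  by (induction w) (auto simp: run_step_def)

lemma foldl_run_step:
  "foldl (run_step E) (Some (x, c)) w = map_option (\<lambda>p. (fst p, c + snd p)) (run E x w)"
proof (induction w rule: rev_induct)
  case (snoc l w)
  then show ?case
    by (auto simp: run_def run_step_def split: option.split)
qed (simp add: run_def)

lemma run_append:
  "run E x (u @ v) = Some (z, e) \<longleftrightarrow>
    (\<exists>y c d. run E x u = Some (y, c) \<and> run E y v = Some (z, d) \<and> e = c + d)"
proof (cases "run E x u")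
  case None
  then show ?thesis by (simp add: run_def foldl_run_step_None)
next
  case (Some p)
  then have "run E x (u @ v) = map_option (\<lambda>q. (fst q, snd p + snd q)) (run E (fst p) v)"
    using foldl_run_step[of E "fst p" "snd p" v] by (simp add: run_def)
  then show ?thesis using Some by (cases p) auto
qed

lemma run_single: "run E x [l] = lookup E x l"
  by (auto simp: run_def run_step_def split: option.split)

lemma run_Cons:
  "run E x (l # v) = Some (z, e) \<longleftrightarrow>
    (\<exists>y c d. lookup E x l = Some (y, c) \<and> run E y v = Some (z, d) \<and> e = c + d)"
  using run_append[of E x "[l]" v] by (simp add: run_single)

text \<open>A letter followed by its inverse leads back to the same state with total weight 0, so
  free cancellation changes neither the end nor the weight of a run.\<close>

lemma run_push:
  assumes "inverse_automaton E" "lookup E x l = Some (y, c)" "run E y v = Some (z, d)"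
  shows "run E x (push l v) = Some (z, c + d)"
proof (cases "v \<noteq> [] \<and> hd v = flip l")
  case True
  then obtain v' where "v = flip l # v'" by (cases v) auto
  then show ?thesis using assms lookup_flip[OF assms(1,2)] by (auto simp: run_Cons)
next
  case False
  then have "push l v = l # v" by (cases v) (auto simp: push_Cons)
  then show ?thesis using assms by (auto simp: run_Cons)
qed

lemma run_fmult:
  assumes "inverse_automaton E"
  shows "run E x u = Some (y, c) \<Longrightarrow> run E y v = Some (z, d) \<Longrightarrow>
    run E x (fmult u v) = Some (z, c + d)"
proof (induction u arbitrary: x c)
  case (Cons l u)
  from Cons.prems(1) obtain x' c1 c2 where
    "lookup E x l = Some (x', c1)" "run E x' u = Some (y, c2)" "c = c1 + c2"
    by (auto simp: run_Cons)
  then show ?case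
    using run_push[OF assms, of x l x' c1 "fmult u v" z "c2 + d"] Cons.IH[OF _ Cons.prems(2)]
    by (simp add: fmult_Cons algebra_simps)
qed simp

lemma run_inv_word:
  assumes "inverse_automaton E"
  shows "run E x u = Some (y, c) \<Longrightarrow> run E y (inv_word u) = Some (x, - c)"
proof (induction u arbitrary: x c)
  case (Cons l u)
  then obtain x' c1 c2 where "lookup E x l = Some (x', c1)" "run E x' u = Some (y, c2)" "c = c1 + c2"
    by (auto simp: run_Cons)
  then show ?case
    using Cons.IH[of x' c2] lookup_flip[OF assms]
    by (fastforce simp: inv_word_Cons run_append run_single)
qed simp

text \<open>Since \<open>zip\<close> truncates, a short functional acts as if padded with zeros:
  \<open>[]\<close> is the zero functional and \<open>[1]\<close> the first coordinate.\<close>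

definition dot :: "int list \<Rightarrow> int list \<Rightarrow> int" where
  "dot lam a = foldl (\<lambda>s p. s + fst p * snd p) 0 (zip lam a)"

lemma dot_Nil [simp]: "dot [] a = 0" "dot lam [] = 0"
  by (simp_all add: dot_def)

lemma dot_Cons [simp]: "dot (c # lam) (x # a) = c * x + dot lam a"
proof -
  have "foldl (\<lambda>s p. s + fst p * snd p) t ps = t + foldl (\<lambda>s p. s + fst p * snd p) 0 ps"
    for t :: int and ps
  proof (induction ps arbitrary: t)
    case (Cons p ps)
    show ?case using Cons[of "t + fst p * snd p"] Cons[of "fst p * snd p"] by simp
  qed simp
  from this[of "c * x" "zip lam a"] show ?thesis by (simp add: dot_def)
qed

lemma dot_add: "length a = length b \<Longrightarrow> dot lam (map2 (+) a b) = dot lam a + dot lam b"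
proof (induction a b arbitrary: lam rule: list_induct2)
  case (Cons x a y b)
  then show ?case by (cases lam) (auto simp: algebra_simps)
qed simp

lemma dot_uminus: "dot lam (map uminus a) = - dot lam a"
proof (induction a arbitrary: lam)
  case (Cons x a)
  then show ?case by (cases lam) (auto simp: algebra_simps)
qed simp

lemma dot_replicate_0 [simp]: "dot lam (replicate m 0) = 0"
proof (induction m arbitrary: lam)
  case (Suc m)
  then show ?case by (cases lam) auto
qed simp

text \<open>A triple \<open>(E, lam, N)\<close> describes the action of $F_n \times Z^m$ on pairs of a state and a residue
  modulo \<open>N\<close>, where \<open>lam\<close> gives the translations by the central generators. An element closes if it
  fixes the pair \<open>(0, 0)\<close>.\<close>

type_synonym weighted_automaton = "edge list \<times> int list \<times> nat"

definition closes :: "weighted_automaton \<Rightarrow> letter list \<times> int list \<Rightarrow> bool" where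
  "closes A g = (case run (fst A) 0 (fst g) of None \<Rightarrow> False
     | Some p \<Rightarrow> fst p = 0 \<and> int (snd (snd A)) dvd snd p + dot (fst (snd A)) (snd g))"

definition stabilises :: "weighted_automaton \<Rightarrow> (letter list \<times> int list) list \<Rightarrow> bool" where
  "stabilises A S \<longleftrightarrow> inverse_automaton (fst A) \<and> (\<forall>s\<in>set S. closes A s)"

lemma closes_iff:
  "closes (E, lam, N) (w, a) \<longleftrightarrow> (\<exists>c. run E 0 w = Some (0, c) \<and> int N dvd c + dot lam a)"
  by (auto simp: closes_def split: option.split)

lemma closes_mult:
  assumes "inverse_automaton (fst A)" "closes A g" "closes A h" "length (snd g) = length (snd h)"
  shows "closes A (elt_mult g h)"
proof -
  obtain E lam N where A: "A = (E, lam, N)" by (metis prod_cases3)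
  obtain c d where c: "run E 0 (fst g) = Some (0, c)" "int N dvd c + dot lam (snd g)"
    and d: "run E 0 (fst h) = Some (0, d)" "int N dvd d + dot lam (snd h)"
    using assms(2,3) by (cases g, cases h) (auto simp: A closes_iff)
  have "int N dvd (c + dot lam (snd g)) + (d + dot lam (snd h))" using c(2) d(2) by (rule dvd_add)
  then show ?thesis
    using run_fmult[OF _ c(1) d(1)] assms(1,4)
    by (auto simp: A closes_iff elt_mult_def dot_add algebra_simps)
qed

lemma closes_inv:
  assumes "inverse_automaton (fst A)" "closes A g"
  shows "closes A (elt_inv g)"
proof -
  obtain E lam N where A: "A = (E, lam, N)" by (metis prod_cases3)
  obtain c where c: "run E 0 (fst g) = Some (0, c)" "int N dvd c + dot lam (snd g)"
    using assms(2) by (cases g) (auto simp: A closes_iff)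
  have "- c - dot lam (snd g) = - (c + dot lam (snd g))" by simp
  then have "int N dvd - c - dot lam (snd g)" using c(2) by (simp only: dvd_minus_iff)
  then show ?thesis
    using run_inv_word[OF _ c(1)] assms(1) by (auto simp: A closes_iff elt_inv_def dot_uminus)
qed

text \<open>Closing is inherited by products and inverses. Read contrapositively, an automaton
  stabilising \<open>S\<close> in which \<open>h\<close> does not close is a finite proof that
  \<open>h\<close> lies outside the subgroup.\<close>

lemma closes_generate:
  assumes S: "set S \<subseteq> carrier (FZ n m)" and A: "stabilises A S"
    and h: "h \<in> generate (FZ n m) (set S)"
  shows "closes A h"
  using h
proof induction
  case one
  then show ?case by (simp add: one_FZ closes_def)
next
  case (incl h)
  then show ?case using A by (simp add: stabilises_def)
next
  case (inv h)
  then have "h \<in> carrier (FZ n m)" using S by blast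
  then show ?case using A inv closes_inv by (simp add: stabilises_def inv_FZ)
next
  case (eng g h)
  then have "g \<in> carrier (FZ n m)" "h \<in> carrier (FZ n m)"
    using group.generate_in_carrier[OF group_FZ S] by blast+
  then show ?case
    using A eng.IH by (auto simp: mult_FZ stabilises_def carrier_FZ intro!: closes_mult)
qed

section \<open>Separating a vector from a lattice\<close>

definition comb :: "int \<Rightarrow> int \<Rightarrow> int list \<Rightarrow> int list \<Rightarrow> int list" where
  "comb p q a b = map2 (\<lambda>x y. p * x + q * y) a b"

text \<open>These are the subgroups of Z^m; integer combinations of two vectors cover sums, inverses
  and multiples at once.\<close>

definition lattice :: "nat \<Rightarrow> int list set \<Rightarrow> bool" where
  "lattice m L \<longleftrightarrow> (\<forall>a\<in>L. length a = m) \<and> replicate m 0 \<in> L \<and> (\<forall>a\<in>L. \<forall>b\<in>L. \<forall>p q. comb p q a b \<in> L)"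

lemma lattice_comb: "lattice m L \<Longrightarrow> a \<in> L \<Longrightarrow> b \<in> L \<Longrightarrow> comb p q a b \<in> L"
  by (simp add: lattice_def)

lemma length_comb [simp]: "length (comb p q a b) = min (length a) (length b)"
  by (simp add: comb_def)

lemma comb_Cons [simp]: "comb p q (x # a) (y # b) = (p * x + q * y) # comb p q a b"
  by (simp add: comb_def)

lemma dot_comb: "length a = length b \<Longrightarrow> dot lam (comb p q a b) = p * dot lam a + q * dot lam b"
proof (induction a b arbitrary: lam rule: list_induct2)
  case (Cons x a y b)
  then show ?case by (cases lam) (auto simp: algebra_simps)
qed (simp add: comb_def)

lemma dot_map_mult_left: "dot (map ((*) d) lam) a = d * dot lam a"
proof (induction a arbitrary: lam)
  case (Cons x a)
  then show ?case by (cases lam) (auto simp: algebra_simps)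
qed simp

lemma lattice_tail:
  assumes "lattice (Suc m) L" shows "lattice m {l. 0 # l \<in> L}"
proof -
  have "0 # comb p q a b \<in> L" if "0 # a \<in> L" "0 # b \<in> L" for p q a b
    using lattice_comb[OF assms that, of p q] by simp
  then show ?thesis using assms by (auto simp: lattice_def)
qed

text \<open>The first coordinates of the lattice vectors form an ideal of the integers, which is
  zero or generated by its least positive element.\<close>

lemma lattice_head_cases:
  assumes L: "lattice (Suc m) L"
  obtains "\<And>x l. x # l \<in> L \<Longrightarrow> x = 0"
  | d e where "0 < d" "int d # e \<in> L" "\<And>x l. x # l \<in> L \<Longrightarrow> int d dvd x"
proof (cases "\<exists>x l. x # l \<in> L \<and> x \<noteq> 0")
  case True
  then obtain x l where x: "x # l \<in> L" "x \<noteq> 0" by blast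
  define P where "P = (\<lambda>d. 0 < d \<and> (\<exists>e. int d # e \<in> L))"
  have "comb (sgn x) 0 (x # l) (x # l) \<in> L" using L x(1) x(1) by (rule lattice_comb)
  moreover have "sgn x * x = int (nat \<bar>x\<bar>)" by (simp add: sgn_if)
  ultimately have "\<exists>e. int (nat \<bar>x\<bar>) # e \<in> L" unfolding comb_Cons by auto
  then have "P (nat \<bar>x\<bar>)" using x by (simp add: P_def)
  then have P: "P (LEAST d. P d)" by (rule LeastI)
  define d where "d = (LEAST d. P d)"
  obtain e where e: "0 < d" "int d # e \<in> L" using P by (auto simp: P_def d_def)
  have "int d dvd y" if y: "y # l' \<in> L" for y l'
  proof (rule ccontr)
    assume nd: "\<not> int d dvd y"
    \<comment> \<open>Euclidean division: a non-zero remainder would be a smaller positive first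
      coordinate.\<close>
    have "comb 1 (- (y div int d)) (y # l') (int d # e) \<in> L"
      using L y e(2) by (rule lattice_comb)
    moreover have "y + - (y div int d) * int d = int (nat (y mod int d))"
      using e by (simp add: minus_div_mult_eq_mod)
    ultimately have "\<exists>e. int (nat (y mod int d)) # e \<in> L" by auto
    moreover have "y mod int d \<noteq> 0" using nd unfolding dvd_eq_mod_eq_0 .
    then have "0 < nat (y mod int d)" using e pos_mod_sign[of "int d" y] by linarith
    ultimately have "d \<le> nat (y mod int d)" unfolding d_def by (intro Least_le) (auto simp: P_def)
    moreover have "nat (y mod int d) < d" using e pos_mod_bound[of "int d" y] by linarith
    ultimately show False by simp
  qed
  with e show ?thesis by (rule that(2))
qed (use that(1) in blast)

text \<open>Induction on the dimension, clearing the first coordinate with a lattice vector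
  \<open>int d # e\<close> whose head generates all heads. If such a vector exists and
  \<open>d\<close> does not divide the head of \<open>b\<close>, the first coordinate modulo
  \<open>d\<close> already separates.\<close>

lemma separate_from_lattice:
  assumes "lattice m L" "length b = m" "b \<notin> L"
  shows "\<exists>lam N. (\<forall>l\<in>L. int N dvd dot lam l) \<and> \<not> int N dvd dot lam b"
  using assms
proof (induction m arbitrary: L b)
  case 0
  then show ?case by (simp add: lattice_def)
next
  case (Suc m)
  obtain x b' where b: "b = x # b'" and len: "length b' = m" using Suc.prems(2) by (cases b) auto
  note IH = Suc.IH[OF lattice_tail[OF Suc.prems(1)]]
  from Suc.prems(1) show ?case
  proof (cases rule: lattice_head_cases)
    case 1
    have L: "\<exists>l'. l = 0 # l' \<and> 0 # l' \<in> L" if "l \<in> L" for l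
      using that Suc.prems(1) 1 by (cases l) (auto simp: lattice_def)
    show ?thesis
    proof (cases "x = 0")
      case True
      then obtain lam N where "\<forall>l\<in>{l. 0 # l \<in> L}. int N dvd dot lam l" "\<not> int N dvd dot lam b'"
        using IH[OF len] Suc.prems(3) b by auto
      then show ?thesis using L b by (intro exI[of _ "0 # lam"] exI[of _ N]) fastforce
    next
      case False
      \<comment> \<open>All lattice vectors begin with 0 and \<open>b\<close> does not, so the first
        coordinate separates; modulus 0 stands for equality.\<close>
      then show ?thesis using L b by (intro exI[of _ "[1]"] exI[of _ 0]) fastforce
    qed
  next
    case (2 d e)
    have len_e: "length e = m" using 2(2) Suc.prems(1) by (auto simp: lattice_def)
    show ?thesis
    proof (cases "int d dvd x")
      case False
      have "int d dvd dot [1] l" if "l \<in> L" for l using 2(3) that by (cases l) auto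
      then show ?thesis using False b by (intro exI[of _ "[1]"] exI[of _ d]) auto
    next
      case True
      then obtain q where q: "x = int d * q" by (elim dvdE)
      \<comment> \<open>The tail of \<open>b\<close> minus \<open>q\<close> times
        \<open>int d # e\<close>, whose first coordinate is 0.\<close>
      let ?b = "comb 1 (- q) b' e"
      have "0 # ?b \<notin> L"
      proof
        assume "0 # ?b \<in> L"
        from lattice_comb[OF Suc.prems(1) this 2(2), of 1 q]
        have "q * int d # comb 1 q ?b e \<in> L" by simp
        moreover have "comb 1 q ?b e = b'" using len len_e by (auto simp: comb_def intro!: nth_equalityI)
        ultimately show False using Suc.prems(3) b q by (simp add: mult.commute)
      qed
      then obtain lam N where lam: "\<And>l. 0 # l \<in> L \<Longrightarrow> int N dvd dot lam l" "\<not> int N dvd dot lam ?b"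
        using IH[of ?b] len len_e by auto
      \<comment> \<open>An extension of \<open>d\<close> times \<open>lam\<close> that vanishes on
        \<open>int d # e\<close>. Scaling by \<open>d\<close> keeps the new coefficient integral,
        and the modulus is scaled along.\<close>
      let ?lam = "- dot lam e # map ((*) (int d)) lam"
      have key: "dot ?lam (int d * r # l) = int d * dot lam (comb 1 (- r) l e)" if "length l = m" for r l
        using that len_e by (simp add: dot_comb dot_map_mult_left algebra_simps)
      have "int (d * N) dvd dot ?lam l" if "l \<in> L" for l
      proof -
        have "length l = Suc m" using that Suc.prems(1) by (simp add: lattice_def)
        then obtain y l' where l: "l = y # l'" "length l' = m" by (cases l) auto
        have "int d dvd y" using 2(3)[of y l'] that l by simp
        then obtain r where r: "y = int d * r" by (elim dvdE)
        have "comb 1 (- r) (y # l') (int d # e) \<in> L" using lattice_comb[OF Suc.prems(1) _ 2(2)] that l by blast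
        then have "int N dvd dot lam (comb 1 (- r) l' e)" using r by (intro lam) (simp add: mult.commute)
        then show ?thesis using key[OF l(2), of r] l r 2(1) by simp
      qed
      moreover have "\<not> int (d * N) dvd dot ?lam b"
        using key[OF len, of q] b q lam(2) 2(1) by simp
      ultimately show ?thesis by blast
    qed
  qed
qed

text \<open>The rational counterpart of \<open>separate_from_lattice\<close>: the hypothesis places
  \<open>b\<close> outside the rational span of \<open>L\<close>, and clearing denominators makes
  the annihilating functional integral.\<close>

lemma annihilate_lattice:
  assumes "lattice m L" "length b = m" "\<And>k. 0 < k \<Longrightarrow> map ((*) k) b \<notin> L"
  shows "\<exists>lam. (\<forall>l\<in>L. dot lam l = 0) \<and> dot lam b \<noteq> 0"
  using assms
proof (induction m arbitrary: L b)
  case 0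
  then show ?case using "0.prems"(3)[of 1] by (simp add: lattice_def)
next
  case (Suc m)
  obtain x b' where b: "b = x # b'" and len: "length b' = m" using Suc.prems(2) by (cases b) auto
  note IH = Suc.IH[OF lattice_tail[OF Suc.prems(1)]]
  from Suc.prems(1) show ?case
  proof (cases rule: lattice_head_cases)
    case 1
    have L: "\<exists>l'. l = 0 # l' \<and> 0 # l' \<in> L" if "l \<in> L" for l
      using that Suc.prems(1) 1 by (cases l) (auto simp: lattice_def)
    show ?thesis
    proof (cases "x = 0")
      case True
      then have "map ((*) k) b' \<notin> {l. 0 # l \<in> L}" if "0 < k" for k using Suc.prems(3)[OF that] b by simp
      then obtain lam where "\<forall>l\<in>{l. 0 # l \<in> L}. dot lam l = 0" "dot lam b' \<noteq> 0"
        using IH[OF len] by auto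
      then show ?thesis using L b by (intro exI[of _ "0 # lam"]) fastforce
    next
      case False
      then show ?thesis using L b by (intro exI[of _ "[1]"]) fastforce
    qed
  next
    case (2 d e)
    have len_e: "length e = m" using 2(2) Suc.prems(1) by (auto simp: lattice_def)
    \<comment> \<open>The tail of \<open>d\<close> times \<open>b\<close> minus \<open>x\<close>
      times \<open>int d # e\<close>. As \<open>d\<close> may fail to divide \<open>x\<close>,
      \<open>b\<close> itself is scaled first.\<close>
    let ?b = "comb (int d) (- x) b' e"
    have "map ((*) k) ?b \<notin> {l. 0 # l \<in> L}" if k: "0 < k" for k
    proof
      assume "map ((*) k) ?b \<in> {l. 0 # l \<in> L}"
      then have "0 # map ((*) k) ?b \<in> L" by simp
      from lattice_comb[OF Suc.prems(1) this 2(2), of 1 "k * x"]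
      have "k * x * int d # comb 1 (k * x) (map ((*) k) ?b) e \<in> L" by simp
      moreover have "comb 1 (k * x) (map ((*) k) ?b) e = map ((*) (k * int d)) b'"
        using len len_e by (auto simp: comb_def algebra_simps intro!: nth_equalityI)
      ultimately have "map ((*) (k * int d)) b \<in> L" using b by (simp add: algebra_simps)
      then show False using Suc.prems(3)[of "k * int d"] k 2(1) by simp
    qed
    then obtain lam where lam: "\<And>l. 0 # l \<in> L \<Longrightarrow> dot lam l = 0" "dot lam ?b \<noteq> 0"
      using IH[of ?b] len len_e by auto
    let ?lam = "- dot lam e # map ((*) (int d)) lam"
    have key: "dot ?lam (y # l) = dot lam (comb (int d) (- y) l e)" if "length l = m" for y l
      using that len_e by (simp add: dot_comb dot_map_mult_left algebra_simps)
    have "dot ?lam l = 0" if "l \<in> L" for l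
    proof -
      have "length l = Suc m" using that Suc.prems(1) by (simp add: lattice_def)
      then obtain y l' where l: "l = y # l'" "length l' = m" by (cases l) auto
      have "comb (int d) (- y) (y # l') (int d # e) \<in> L" using lattice_comb[OF Suc.prems(1) _ 2(2)] that l by blast
      then show ?thesis using key[OF l(2), of y] l by (simp add: lam(1))
    qed
    moreover have "dot ?lam b \<noteq> 0" using key[OF len, of x] b lam(2) by simp
    ultimately show ?thesis by blast
  qed
qed

section \<open>Finite pieces of coset graphs\<close>

text \<open>States are named by codes of representatives; the empty word has code 0, which is the
  base state in \<open>closes\<close>.\<close>

definition word_code :: "letter list \<Rightarrow> nat" where
  "word_code w = list_encode (map enc_letter w)"

lemma inj_enc_letter: "inj enc_letter"
proof (rule injI)
  fix x y assume eq: "enc_letter x = enc_letter y"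
  have "odd (enc_letter x) = snd x" "enc_letter x div 2 = fst x" for x
    by (auto simp: enc_letter_def)
  from this[of x] this[of y] show "x = y" using eq by (simp add: prod_eq_iff)
qed

lemma word_code_inject [simp]: "word_code u = word_code v \<longleftrightarrow> u = v"
  by (simp add: word_code_def list_encode_eq inj_map_eq_map[OF inj_enc_letter])

lemma word_code_eq_0 [simp]: "word_code u = 0 \<longleftrightarrow> u = []"
  using word_code_inject[of u "[]"] by (simp add: word_code_def)

text \<open>The words in \<open>V\<close> determine which cosets become states, and
  \<open>lam\<close> turns vectors into weights. The cosets are those of the projection of
  \<open>H\<close> to the free group.\<close>

locale coset_graph =
  fixes n m :: nat and H :: "(letter list \<times> int list) set" and lam :: "int list"
    and V :: "letter list set"
  assumes subgroup: "subgroup H (FZ n m)" and finite_V: "finite V"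
begin

text \<open>\<open>related b w z\<close>: the elements \<open>(w, b)\<close> and \<open>(z, 0)\<close> lie in the same right coset of \<open>H\<close>.\<close>

definition related :: "int list \<Rightarrow> letter list \<Rightarrow> letter list \<Rightarrow> bool" where
  "related b w z \<longleftrightarrow> (\<exists>x. (x, b) \<in> H \<and> w = fmult x z)"

lemmas H_D = subgroup_FZ_D[OF subgroup]

lemma related_length: "related b w z \<Longrightarrow> length b = m"
  using H_D(2) by (auto simp: related_def)

lemma related_refl: "related (replicate m 0) w w"
  using H_D(3) by (auto simp: related_def intro!: exI[of _ "[]"])

lemma related_trans:
  assumes "related b w z" "related b' z y" "y \<in> words n"
  shows "related (map2 (+) b b') w y"
proof -
  obtain x x' where x: "(x, b) \<in> H" "w = fmult x z" and x': "(x', b') \<in> H" "z = fmult x' y"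
    using assms(1,2) by (auto simp: related_def)
  have "w = fmult (fmult x x') y" using x x' words_reduced[OF assms(3)] by (simp add: fmult_assoc)
  then show ?thesis using H_D(4)[OF x(1) x'(1)] by (auto simp: related_def)
qed

lemma related_sym:
  assumes "related b w z" "z \<in> words n"
  shows "related (map uminus b) z w"
proof -
  obtain x where x: "(x, b) \<in> H" "w = fmult x z" using assms by (auto simp: related_def)
  then have "z = fmult (inv_word x) w"
    using fmult_inv_word_left[OF words_reduced[OF assms(2)], of x] by simp
  then show ?thesis using H_D(5)[OF x(1)] by (auto simp: related_def)
qed

lemma related_fmult:
  assumes "related b w z" "v \<in> words n"
  shows "related b (fmult w v) (fmult z v)"
  using assms(1) fmult_assoc[OF words_reduced[OF assms(2)]] by (auto simp: related_def)

lemma related_Nil: "related b w [] \<longleftrightarrow> (w, b) \<in> H"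
proof
  assume "related b w []"
  then obtain x where x: "(x, b) \<in> H" "w = fmult x []" by (auto simp: related_def)
  then show "(w, b) \<in> H" using words_reduced[OF H_D(1)[OF x(1)]] by simp
next
  assume "(w, b) \<in> H"
  then show "related b w []"
    using words_reduced[OF H_D(1)] by (auto simp: related_def intro!: exI[of _ w])
qed

text \<open>One representative per coset. The coset of the empty word must be represented by the
  empty word, since the base state is 0; elsewhere any choice will do.\<close>

definition rep :: "letter list \<Rightarrow> letter list" where
  "rep w = (if \<exists>b. (w, b) \<in> H then [] else SOME z. z \<in> words n \<and> (\<exists>b. related b w z))"

lemma rep:
  assumes "w \<in> words n"
  shows "rep w \<in> words n" "\<exists>b. related b w (rep w)"
proof -
  have "rep w \<in> words n \<and> (\<exists>b. related b w (rep w))"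
  proof (cases "\<exists>b. (w, b) \<in> H")
    case True
    then show ?thesis by (simp add: rep_def related_Nil)
  next
    case False
    have "\<exists>z. z \<in> words n \<and> (\<exists>b. related b w z)" using assms related_refl by blast
    then have "(SOME z. z \<in> words n \<and> (\<exists>b. related b w z)) \<in> words n \<and>
        (\<exists>b. related b w (SOME z. z \<in> words n \<and> (\<exists>b. related b w z)))" by (rule someI_ex)
    then show ?thesis using False by (simp only: rep_def if_False)
  qed
  then show "rep w \<in> words n" "\<exists>b. related b w (rep w)" by simp_all
qed

text \<open>Words of one coset satisfy the same predicate under \<open>SOME\<close>, so the choice
  falls on the same word.\<close>

lemma rep_cong:
  assumes "related b w w'" "w \<in> words n" "w' \<in> words n"
  shows "rep w = rep w'"
proof -
  have *: "(\<exists>b. related b w z) \<longleftrightarrow> (\<exists>b. related b w' z)" if "z \<in> words n" for z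
  proof
    assume "\<exists>b. related b w z"
    then obtain b' where "related b' w z" by blast
    from related_trans[OF related_sym[OF assms(1,3)] this that] show "\<exists>b. related b w' z" by blast
  next
    assume "\<exists>b. related b w' z"
    then obtain b' where "related b' w' z" by blast
    from related_trans[OF assms(1) this that] show "\<exists>b. related b w z" by blast
  qed
  then have "(\<lambda>z. z \<in> words n \<and> (\<exists>b. related b w z)) = (\<lambda>z. z \<in> words n \<and> (\<exists>b. related b w' z))"
    by (intro ext conj_cong refl) auto
  moreover have "(\<exists>b. (w, b) \<in> H) \<longleftrightarrow> (\<exists>b. (w', b) \<in> H)"
    using *[OF words_Nil] by (simp add: related_Nil)
  ultimately show ?thesis by (simp add: rep_def)
qed

lemma rep_eq_Nil:
  assumes "w \<in> words n" shows "rep w = [] \<longleftrightarrow> (\<exists>b. (w, b) \<in> H)"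
  using rep(2)[OF assms] by (auto simp: rep_def related_Nil)

lemma rep_Nil [simp]: "rep [] = []"
  using H_D(3) by (auto simp: rep_def)

lemma rep_rep: "w \<in> words n \<Longrightarrow> rep (rep w) = rep w"
  using rep[of w] rep_cong[of _ w "rep w"] by auto

lemma rep_fmult:
  assumes "w \<in> words n" "v \<in> words n" shows "rep (fmult (rep w) v) = rep (fmult w v)"
proof -
  obtain b where "related b w (rep w)" using rep(2)[OF assms(1)] by blast
  from rep_cong[OF related_fmult[OF this assms(2)]] show ?thesis
    using assms rep(1) words_fmult by simp
qed

text \<open>As with Schreier generators, replacing a word by its representative costs an element of
  \<open>H\<close>. Its vector \<open>b\<close> is fixed only up to central vectors of
  \<open>H\<close>, hence the choice; the sign lets the weight cancel against \<open>dot lam\<close>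
  in \<open>closes\<close>.\<close>

definition weight :: "letter list \<Rightarrow> nat \<Rightarrow> int" where
  "weight y i = - dot lam (SOME b. related b (fmult y [(i, False)]) (rep (fmult y [(i, False)])))"

definition states :: "letter list set" where
  "states = rep ` (V \<inter> words n)"

definition edge_set :: "edge set" where
  "edge_set = (\<lambda>(y, i). (word_code y, i, word_code (rep (fmult y [(i, False)])), weight y i)) `
     {(y, i). y \<in> states \<and> i < n \<and> rep (fmult y [(i, False)]) \<in> states}"

definition edges :: "edge list" where
  "edges = (SOME E. set E = edge_set)"

lemma set_edges: "set edges = edge_set"
proof -
  have "finite {(y, i). y \<in> states \<and> i < n \<and> rep (fmult y [(i, False)]) \<in> states}"
    by (rule finite_subset[of _ "states \<times> {..<n}"]) (use finite_V in \<open>auto simp: states_def\<close>)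
  then have "finite edge_set" unfolding edge_set_def by (rule finite_imageI)
  then have "\<exists>E. set E = edge_set" by (rule finite_list)
  then show ?thesis unfolding edges_def by (rule someI_ex)
qed

lemma edges_iff: "(x, i, z, c) \<in> set edges \<longleftrightarrow> (\<exists>y\<in>states. i < n \<and> rep (fmult y [(i, False)]) \<in> states \<and>
    x = word_code y \<and> z = word_code (rep (fmult y [(i, False)])) \<and> c = weight y i)"
  by (auto simp: set_edges edge_set_def)

lemma letter_words: "fst l < n \<Longrightarrow> [l] \<in> words n"
  by (simp add: words_def)

lemma states_words: "y \<in> states \<Longrightarrow> y \<in> words n \<and> rep y = y"
  by (auto simp: states_def rep rep_rep)

lemma fmult_letter_flip:
  assumes "w \<in> words n" shows "fmult (fmult w [l]) [flip l] = w"
proof -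
  have "fmult (fmult w [l]) [flip l] = fmult w (fmult [l] [flip l])"
    by (rule fmult_assoc) simp
  also have "fmult [l] [flip l] = []" by (simp add: fmult_Cons)
  finally show ?thesis using words_reduced[OF assms] by simp
qed

text \<open>Letters permute the cosets, a flipped letter undoing the letter. Uniqueness of incoming
  edges follows.\<close>

lemma rep_back:
  assumes "y \<in> states" "fst l < n"
  shows "rep (fmult (rep (fmult y [l])) [flip l]) = y"
  using assms states_words[OF assms(1)] fmult_letter_flip[of y l]
    rep_fmult[of "fmult y [l]" "[flip l]"] letter_words[of l] letter_words[of "flip l"]
  by (simp add: words_fmult)

lemma inverse_automaton_edges: "inverse_automaton edges"
proof (rule inverse_automatonI)
  fix x i y c x' c'
  assume "(x, i, y, c) \<in> set edges" "(x', i, y, c') \<in> set edges"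
  then obtain u v where u: "u \<in> states" "x = word_code u" "c = weight u i"
      "y = word_code (rep (fmult u [(i, False)]))"
    and v: "v \<in> states" "x' = word_code v" "c' = weight v i"
      "y = word_code (rep (fmult v [(i, False)]))" and i: "i < n"
    by (auto simp: edges_iff)
  have "u = v" using rep_back[OF u(1), of "(i, False)"] rep_back[OF v(1), of "(i, False)"] i u(4) v(4)
    by simp
  then show "x = x' \<and> c = c'" using u v by simp
qed (auto simp: edges_iff)

lemma weight:
  assumes "y \<in> words n" "i < n"
  obtains b where "related b (fmult y [(i, False)]) (rep (fmult y [(i, False)]))"
    "weight y i = - dot lam b"
proof -
  have "\<exists>b. related b (fmult y [(i, False)]) (rep (fmult y [(i, False)]))"
    by (rule rep) (simp add: assms words_fmult letter_words)
  from someI_ex[OF this] show ?thesis by (rule that) (simp add: weight_def)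
qed

lemma lookup_edges:
  assumes w: "w \<in> words n" and l: "lookup edges (word_code (rep w)) l = Some (z, c)"
  obtains b where "fst l < n" "z = word_code (rep (fmult w [l]))" "c = - dot lam b"
    "related b (fmult (rep w) [l]) (rep (fmult w [l]))"
proof (cases "snd l")
  case False
  then have "(word_code (rep w), fst l, z, c) \<in> set edges"
    using lookup_False_Some[of edges _ "fst l"] l by (cases l) auto
  then have *: "fst l < n" "z = word_code (rep (fmult (rep w) [l]))" "c = weight (rep w) (fst l)"
    using False by (cases l; auto simp: edges_iff)+
  have "(fst l, False) = l" using False by (simp add: prod_eq_iff)
  then obtain b where b: "related b (fmult (rep w) [l]) (rep (fmult (rep w) [l]))" "c = - dot lam b"
    using weight[OF rep(1)[OF w] *(1)] *(3) by metis
  then show ?thesis using that[of b] * rep_fmult[OF w letter_words[of l]] by simp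
next
  case True
  then have "(z, fst l, word_code (rep w), - c) \<in> set edges"
    using lookup_True_Some[of edges _ "fst l"] l by (cases l) auto
  then obtain y where y: "y \<in> states" "fst l < n" "z = word_code y" "- c = weight y (fst l)"
      "rep w = rep (fmult y [flip l])"
    using True by (cases l) (auto simp: edges_iff flip_def)
  have yw: "y \<in> words n" using states_words[OF y(1)] by simp
  have "(fst l, False) = flip l" using True by (simp add: flip_def)
  then obtain b where b: "related b (fmult y [flip l]) (rep (fmult y [flip l]))" "weight y (fst l) = - dot lam b"
    using weight[OF yw y(2)] by metis
  have fl: "[flip l] \<in> words n" "[l] \<in> words n" using y(2) by (simp_all add: letter_words)
  \<comment> \<open>An inverse letter follows the edge from \<open>y\<close> backwards. Multiplying
    the relation of that edge by \<open>l\<close> and reversing it gives the relation of this step,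
    with \<open>b\<close> negated like the weight.\<close>
  have "related b (fmult (fmult y [flip l]) [l]) (fmult (rep w) [l])"
    using related_fmult[OF b(1) fl(2)] y(5) by simp
  then have "related b y (fmult (rep w) [l])" using fmult_letter_flip[OF yw, of "flip l"] by simp
  then have r: "related (map uminus b) (fmult (rep w) [l]) y"
    by (rule related_sym) (simp add: words_fmult rep w fl)
  have "rep (fmult w [l]) = y"
    using rep_cong[OF r] states_words[OF y(1)] rep_fmult[OF w fl(2)] by (simp add: words_fmult rep w fl)
  then show ?thesis using that[of "map uminus b"] y b r by (simp add: dot_uminus)
qed

lemma lookup_edges_defined:
  assumes w: "w \<in> words n" and l: "fst l < n" and s: "rep w \<in> states" "rep (fmult w [l]) \<in> states"
  shows "lookup edges (word_code (rep w)) l \<noteq> None"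
proof (cases "snd l")
  case False
  have "(word_code (rep w), fst l, word_code (rep (fmult w [l])), weight (rep w) (fst l)) \<in> set edges"
    using s l False rep_fmult[OF w letter_words[OF l]]
    by (cases l) (auto simp: edges_iff)
  from lookup_not_None[OF this] show ?thesis using False by (cases l) auto
next
  case True
  let ?y = "rep (fmult w [l])"
  have "rep (fmult ?y [flip l]) = rep w"
    using rep_fmult[of "fmult w [l]" "[flip l]"] w l
    by (simp add: words_fmult letter_words fmult_letter_flip)
  moreover have "flip l = (fst l, False)" using True by (simp add: flip_def)
  ultimately have "(word_code ?y, fst l, word_code (rep w), weight ?y (fst l)) \<in> set edges"
    using s l by (auto simp: edges_iff)
  from lookup_not_None[OF this] show ?thesis using True by (cases l) auto
qed

lemma words_snoc: "w @ [l] \<in> words n \<Longrightarrow> w \<in> words n \<and> fst l < n \<and> fmult w [l] = w @ [l]"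
  using fmult_eq_append[of w "[l]"] words_appendD(1)[of w "[l]"] by (auto simp: words_def)

text \<open>The relations of the single steps compose, and their vectors add up just as the weights
  do.\<close>

lemma run_edges:
  "w \<in> words n \<Longrightarrow> run edges 0 w = Some (z, c) \<Longrightarrow>
    z = word_code (rep w) \<and> (\<exists>b. related b w (rep w) \<and> c = - dot lam b)"
proof (induction w arbitrary: z c rule: rev_induct)
  case Nil
  have "related (replicate m 0) [] []" by (rule related_refl)
  then show ?case using Nil by (force simp: word_code_def)
next
  case (snoc l w)
  note w = words_snoc[OF snoc.prems(1)]
  obtain y c1 c2 where run: "run edges 0 w = Some (y, c1)" "lookup edges y l = Some (z, c2)" "c = c1 + c2"
    using snoc.prems(2) by (auto simp: run_append run_single)
  obtain b1 where b1: "y = word_code (rep w)" "related b1 w (rep w)" "c1 = - dot lam b1"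
    using snoc.IH[OF _ run(1)] w by blast
  have lk: "lookup edges (word_code (rep w)) l = Some (z, c2)" using run(2) b1(1) by simp
  obtain b2 where b2: "z = word_code (rep (fmult w [l]))" "c2 = - dot lam b2"
      "related b2 (fmult (rep w) [l]) (rep (fmult w [l]))"
    using lookup_edges[OF _ lk] w by blast
  have "related b1 (fmult w [l]) (fmult (rep w) [l])"
    using related_fmult[OF b1(2)] w letter_words by blast
  then have "related (map2 (+) b1 b2) (fmult w [l]) (rep (fmult w [l]))"
    using related_trans[OF _ b2(3)] rep(1)[OF snoc.prems(1)] w by simp
  moreover have "c = - dot lam (map2 (+) b1 b2)"
    using run(3) b1 b2 related_length[OF b1(2)] related_length[OF b2(3)] by (simp add: dot_add)
  ultimately show ?case using b2(1) w by auto
qed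

text \<open>An edge exists only if both its ends are states, so the cosets of all prefixes must be
  present.\<close>

lemma run_edges_defined:
  assumes "w \<in> words n" "\<And>u v. w = u @ v \<Longrightarrow> u \<in> V"
  shows "run edges 0 w \<noteq> None"
  using assms
proof (induction w rule: rev_induct)
  case (snoc l w)
  note w = words_snoc[OF snoc.prems(1)]
  have "run edges 0 w \<noteq> None"
  proof (rule snoc.IH)
    show "u \<in> V" if "w = u @ v" for u v using snoc.prems(2)[of u "v @ [l]"] that by simp
  qed (use w in simp)
  then obtain y c where y: "run edges 0 w = Some (y, c)" by auto
  have "w \<in> V" "w @ [l] \<in> V" using snoc.prems(2)[of w "[l]"] snoc.prems(2)[of "w @ [l]" "[]"] by simp_all
  then have "lookup edges (word_code (rep w)) l \<noteq> None"
    using w snoc.prems(1) by (intro lookup_edges_defined) (auto simp: states_def)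
  then obtain p where "lookup edges y l = Some p" using run_edges[OF _ y] w by auto
  then show ?case using y run_append[of edges 0 w "[l]" "fst p" "c + snd p"] by (auto simp: run_single)
qed simp

text \<open>A non-empty run stops at an end of an edge, the empty one at 0. The reachable states are
  thus finite in number, as a later pigeonhole argument needs.\<close>

lemma run_edges_states:
  assumes "w \<in> words n" "run edges 0 w = Some (z, c)"
  shows "z \<in> insert 0 (word_code ` states)"
proof (cases w rule: rev_cases)
  case Nil
  then show ?thesis using assms by simp
next
  case (snoc w' l)
  obtain y c' where "lookup edges y l = Some (z, c')"
    using assms(2) snoc by (auto simp: run_append run_single)
  then show ?thesis
    using lookup_False_Some[of edges y "fst l" z c'] lookup_True_Some[of edges y "fst l" z c']
    by (cases l; cases "snd l") (auto simp: edges_iff)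
qed

end

section \<open>Certificates for the order\<close>

lemma elt_pow_0: "elt_pow m g 0 = ([], replicate m 0)"
  and elt_pow_Suc: "elt_pow m g (Suc k) = elt_mult (elt_pow m g k) g"
  by (simp_all add: elt_pow_def)

lemma elt_pow_carrier: "g \<in> carrier (FZ n m) \<Longrightarrow> elt_pow m g k \<in> carrier (FZ n m)"
  using monoid.nat_pow_closed[OF group.is_monoid[OF group_FZ], of g n m k] by (simp add: pow_FZ)

lemma elt_pow_1: "g \<in> carrier (FZ n m) \<Longrightarrow> elt_pow m g 1 = g"
  using monoid.l_one[OF group.is_monoid[OF group_FZ], of g n m]
  by (simp add: elt_pow_0 elt_pow_Suc mult_FZ one_FZ)

lemma elt_pow_mult: "g \<in> carrier (FZ n m) \<Longrightarrow> elt_pow m (elt_pow m g i) j = elt_pow m g (i * j)"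
  using monoid.nat_pow_pow[OF group.is_monoid[OF group_FZ], of g n m i j] by (simp add: pow_FZ)

lemma elt_pow_subgroup: "subgroup H (FZ n m) \<Longrightarrow> g \<in> H \<Longrightarrow> elt_pow m g k \<in> H"
  by (induction k) (auto simp: elt_pow_0 elt_pow_Suc elt_mult_def intro: subgroup_FZ_D(3,4))

lemma snd_elt_pow: "length (snd g) = m \<Longrightarrow> snd (elt_pow m g k) = map ((*) (int k)) (snd g)"
  by (induction k) (auto simp: elt_pow_0 elt_pow_Suc elt_mult_def algebra_simps intro!: nth_equalityI)

lemma fst_elt_pow_cong: "fst g = fst h \<Longrightarrow> fst (elt_pow m g k) = fst (elt_pow m h k)"
  by (induction k) (auto simp: elt_pow_0 elt_pow_Suc elt_mult_def)

definition power_word :: "letter list \<Rightarrow> letter list \<Rightarrow> nat \<Rightarrow> letter list" where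
  "power_word c v j = ((\<lambda>z. z @ v) ^^ j) c"

text \<open>The equation for the square, in which the two copies of \<open>v\<close> stand side by
  side, says that \<open>v\<close> is cyclically reduced: a product of reduced words is
  reduced.\<close>

definition unreadable_cert ::
  "(letter list \<times> int list) list \<Rightarrow> letter list \<times> int list \<Rightarrow> weighted_automaton \<Rightarrow>
    letter list \<Rightarrow> letter list \<Rightarrow> nat \<Rightarrow> bool"
where
  "unreadable_cert S g A c v j \<longleftrightarrow> stabilises A S \<and> v \<noteq> [] \<and> fst g = c @ v @ inv_word c \<and>
     fmult (fst g) (fst g) = c @ v @ v @ inv_word c \<and> run (fst A) 0 (power_word c v j) = None"

text \<open>With modulus 1 \<open>closes\<close> only tests the return to the base state; with
  modulus 0 it also tests that the drift is exactly 0. Together the conditions say: returns with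
  non-zero drift. \<open>Suc k\<close> keeps the exponent positive.\<close>

definition drift_cert ::
  "nat \<Rightarrow> (letter list \<times> int list) list \<Rightarrow> letter list \<times> int list \<Rightarrow> weighted_automaton \<Rightarrow> nat \<Rightarrow> bool"
where
  "drift_cert m S g A k \<longleftrightarrow> stabilises (fst A, fst (snd A), 0) S \<and>
     closes (fst A, fst (snd A), 1) (elt_pow m g (Suc k)) \<and>
     \<not> closes (fst A, fst (snd A), 0) (elt_pow m g (Suc k))"

text \<open>The fold carries the verdict so far and the current power of \<open>g\<close>, so the
  automaton at position \<open>i\<close> is tested on the power with exponent
  \<open>Suc i\<close>.\<close>

definition exclude_step ::
  "(letter list \<times> int list) list \<Rightarrow> letter list \<times> int list \<Rightarrow> bool \<times> letter list \<times> int list \<Rightarrow>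
    weighted_automaton \<Rightarrow> bool \<times> letter list \<times> int list"
where
  "exclude_step S g p A = (fst p \<and> stabilises A S \<and> \<not> closes A (snd p), elt_mult (snd p) g)"

definition order_cert ::
  "nat \<Rightarrow> (letter list \<times> int list) list \<Rightarrow> letter list \<times> int list \<Rightarrow>
    (letter list \<times> int list) list \<Rightarrow> weighted_automaton list \<Rightarrow> bool"
where
  "order_cert m S g T As \<longleftrightarrow> (\<forall>t\<in>set T. t \<in> set S \<or> elt_inv t \<in> set S) \<and>
     fst (foldl (exclude_step S g) (True, elt_pow m g 1) As) \<and>
     snd (foldl (exclude_step S g) (True, elt_pow m g 1) As) = foldl elt_mult ([], replicate m 0) T"

section \<open>Soundness of the certificates\<close>

lemma power_word_simps [simp]:
  "power_word c v 0 = c" "power_word c v (Suc j) = power_word c v j @ v"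
  by (simp_all add: power_word_def)

lemma power_word_append: "power_word c v j = c @ power_word [] v j"
  by (induction j) auto

lemma power_word_add: "power_word c v (i + j) = power_word c v i @ power_word [] v j"
  by (induction j) auto

text \<open>Reducedness concerns neighbouring letters, and every junction of the long word already
  occurs in \<open>c @ v @ v @ inv_word c\<close>.\<close>

lemma reduced_power_word:
  assumes "reduced (c @ v @ v @ inv_word c)" "v \<noteq> []"
  shows "reduced (power_word c v (Suc k) @ inv_word c)" "reduced (power_word c v k)"
proof -
  have "reduced (power_word c v (Suc k)) \<and> last (power_word c v (Suc k)) = last v \<and> power_word c v (Suc k) \<noteq> []" for k
  proof (induction k)
    case (Suc k)
    then show ?case using assms by (auto simp: reduced_append_iff)
  qed (use assms in \<open>auto simp: reduced_append_iff\<close>)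
  from this[of k] show 1: "reduced (power_word c v (Suc k) @ inv_word c)"
    using assms by (auto simp: reduced_append_iff simp del: power_word_simps)
  show "reduced (power_word c v k)" using 1 by (simp add: reduced_append_iff)
qed

lemma fst_elt_pow_conjugate:
  assumes red: "reduced (c @ v @ v @ inv_word c)" "v \<noteq> []" and g: "fst g = c @ v @ inv_word c"
  shows "fst (elt_pow m g (Suc k)) = power_word c v (Suc k) @ inv_word c"
proof (induction k)
  case 0
  show ?case using g by (simp add: elt_pow_0 elt_pow_Suc elt_mult_def)
next
  case (Suc k)
  let ?p = "power_word c v (Suc k)"
  have rc: "reduced (c @ v @ inv_word c)" and rv: "reduced (v @ inv_word c)"
    using red by (auto simp: reduced_append_iff)
  have rp: "reduced (?p @ v @ inv_word c)" using reduced_power_word(1)[OF red, of "Suc k"] by simp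
  have "fst (elt_pow m g (Suc (Suc k))) = fmult (?p @ inv_word c) (c @ v @ inv_word c)"
    using Suc g by (simp add: elt_pow_Suc[of m g "Suc k"] elt_mult_def)
  also have "\<dots> = fmult ?p (fmult (inv_word c) (fmult c (v @ inv_word c)))"
    by (simp only: fmult_append fmult_eq_append[OF rc])
  also have "\<dots> = fmult ?p (v @ inv_word c)" by (simp only: fmult_inv_word_left[OF rv])
  also have "\<dots> = ?p @ v @ inv_word c" by (rule fmult_eq_append[OF rp])
  finally show ?case by simp
qed

lemma unreadable_cert_sound:
  assumes S: "set S \<subseteq> carrier (FZ n m)" and g: "g \<in> carrier (FZ n m)"
    and cert: "unreadable_cert S g A c v j" and i: "1 \<le> i"
  shows "elt_pow m g i \<notin> generate (FZ n m) (set S)"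
proof
  let ?H = "generate (FZ n m) (set S)"
  assume "elt_pow m g i \<in> ?H"
  \<comment> \<open>The new exponent exceeds \<open>j\<close>, whatever the positive
    \<open>i\<close> is, so the reduced word of this power has \<open>power_word c v j\<close> as a
    prefix.\<close>
  then have "elt_pow m (elt_pow m g i) (Suc j) \<in> ?H"
    by (rule elt_pow_subgroup[OF group.generate_is_subgroup[OF group_FZ S]])
  then have H: "elt_pow m g (i * Suc j) \<in> ?H" by (simp only: elt_pow_mult[OF g])
  have A: "stabilises A S" and v: "v \<noteq> []" and w: "fst g = c @ v @ inv_word c"
    and sq: "fmult (fst g) (fst g) = c @ v @ v @ inv_word c"
    and none: "run (fst A) 0 (power_word c v j) = None"
    using cert by (auto simp: unreadable_cert_def)
  have "reduced (fst g)" using g words_reduced[of "fst g" n] by (simp add: carrier_FZ)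
  then have red: "reduced (c @ v @ v @ inv_word c)" using reduced_fmult[of "fst g" "fst g"] sq by simp
  obtain d where "i = Suc d" using i by (cases i) auto
  then have k: "i * Suc j = Suc (j + d * Suc j)" by simp
  have "fst (elt_pow m g (i * Suc j)) = power_word c v (Suc (j + d * Suc j)) @ inv_word c"
    unfolding k by (rule fst_elt_pow_conjugate[OF red v w])
  then have "\<exists>z. fst (elt_pow m g (i * Suc j)) = power_word c v j @ z"
    by (simp add: power_word_add)
  then obtain z where z: "fst (elt_pow m g (i * Suc j)) = power_word c v j @ z" by blast
  obtain e where "run (fst A) 0 (power_word c v j @ z) = Some (0, e)"
    using closes_generate[OF S A H] z by (auto simp: closes_def split: option.splits)
  then show False using none by (auto simp: run_append)
qed

text \<open>Weight plus functional is additive on elements that return to the base state.\<close>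

lemma run_elt_pow:
  assumes "inverse_automaton E" "run E 0 (fst g) = Some (0, c)" "length (snd g) = m"
  shows "\<exists>d. run E 0 (fst (elt_pow m g k)) = Some (0, d) \<and>
    d + dot lam (snd (elt_pow m g k)) = int k * (c + dot lam (snd g))"
proof (induction k)
  case (Suc k)
  then obtain d where d: "run E 0 (fst (elt_pow m g k)) = Some (0, d)"
    "d + dot lam (snd (elt_pow m g k)) = int k * (c + dot lam (snd g))" by blast
  then show ?case
    using run_fmult[OF assms(1) d(1) assms(2)] assms(3)
    by (auto simp: elt_pow_Suc elt_mult_def dot_add snd_elt_pow algebra_simps)
qed (simp add: elt_pow_0)

lemma drift_cert_sound:
  assumes S: "set S \<subseteq> carrier (FZ n m)" and g: "g \<in> carrier (FZ n m)"
    and cert: "drift_cert m S g A k" and i: "1 \<le> i"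
  shows "elt_pow m g i \<notin> generate (FZ n m) (set S)"
proof
  let ?H = "generate (FZ n m) (set S)"
  assume "elt_pow m g i \<in> ?H"
  then have "elt_pow m (elt_pow m g i) (Suc k) \<in> ?H"
    by (rule elt_pow_subgroup[OF group.generate_is_subgroup[OF group_FZ S]])
  \<comment> \<open>Interchanging the exponents turns the element into a power of
    \<open>elt_pow m g (Suc k)\<close>, whose drift is known.\<close>
  then have "elt_pow m g (Suc k * i) \<in> ?H" by (simp only: elt_pow_mult[OF g] mult.commute)
  then have H: "elt_pow m (elt_pow m g (Suc k)) i \<in> ?H" by (simp only: elt_pow_mult[OF g])
  let ?h = "elt_pow m g (Suc k)"
  obtain E lam N where A: "A = (E, lam, N)" by (metis prod_cases3)
  have st: "stabilises (E, lam, 0) S" and E: "inverse_automaton E"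
    and cl: "closes (E, lam, 1) (fst ?h, snd ?h)" "\<not> closes (E, lam, 0) (fst ?h, snd ?h)"
    using cert by (auto simp: A drift_cert_def stabilises_def)
  obtain c where c: "run E 0 (fst ?h) = Some (0, c)" "c + dot lam (snd ?h) \<noteq> 0"
    using cl unfolding closes_iff by auto
  have "length (snd ?h) = m" using elt_pow_carrier[OF g, of "Suc k"] by (simp add: carrier_FZ)
  from run_elt_pow[OF E c(1) this] obtain d where d: "run E 0 (fst (elt_pow m ?h i)) = Some (0, d)"
    "d + dot lam (snd (elt_pow m ?h i)) = int i * (c + dot lam (snd ?h))" by blast
  have "closes (E, lam, 0) (fst (elt_pow m ?h i), snd (elt_pow m ?h i))"
    using closes_generate[OF S st H] by simp
  then have "d + dot lam (snd (elt_pow m ?h i)) = 0" using d(1) unfolding closes_iff by simp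
  then show False using d(2) c(2) i by simp
qed

lemma foldl_exclude_step:
  "snd (foldl (exclude_step S g) (True, elt_pow m g 1) As) = elt_pow m g (Suc (length As))"
  "fst (foldl (exclude_step S g) (True, elt_pow m g 1) As) \<longleftrightarrow>
     (\<forall>i<length As. stabilises (As ! i) S \<and> \<not> closes (As ! i) (elt_pow m g (Suc i)))"
proof (induction As rule: rev_induct)
  case (snoc A As)
  {
    case 1
    show ?case using snoc by (simp add: exclude_step_def elt_pow_Suc)
  next
    case 2
    show ?case using snoc by (auto simp: exclude_step_def nth_append less_Suc_eq)
  }
qed simp_all

lemma order_cert_iff:
  assumes S: "set S \<subseteq> carrier (FZ n m)"
  shows "(\<exists>T. order_cert m S g T As) \<longleftrightarrow> elt_pow m g (Suc (length As)) \<in> generate (FZ n m) (set S) \<and>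
    (\<forall>i<length As. stabilises (As ! i) S \<and> \<not> closes (As ! i) (elt_pow m g (Suc i)))"
  unfolding generate_iff_product[OF S] order_cert_def foldl_exclude_step by blast

lemma Ord_in_eq_0: "(\<And>i. 1 \<le> i \<Longrightarrow> elt_pow m g i \<notin> H) \<Longrightarrow> Ord_in (FZ n m) H g = 0"
  by (auto simp: Ord_in_def pow_FZ)

lemma order_cert_sound:
  assumes S: "set S \<subseteq> carrier (FZ n m)" and cert: "order_cert m S g T As"
  shows "Ord_in (FZ n m) (generate (FZ n m) (set S)) g = Suc (length As)"
proof -
  let ?H = "generate (FZ n m) (set S)"
  have mem: "elt_pow m g (Suc (length As)) \<in> ?H"
    and ex: "\<And>i. i < length As \<Longrightarrow> stabilises (As ! i) S \<and> \<not> closes (As ! i) (elt_pow m g (Suc i))"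
    using cert order_cert_iff[OF S, of g As] by blast+
  have "(LEAST k. 1 \<le> k \<and> elt_pow m g k \<in> ?H) = Suc (length As)"
  proof (rule Least_equality)
    fix k assume k: "1 \<le> k \<and> elt_pow m g k \<in> ?H"
    show "Suc (length As) \<le> k"
    proof (rule ccontr)
      assume "\<not> Suc (length As) \<le> k"
      then obtain i where i: "k = Suc i" "i < length As" using k by (cases k) auto
      then show False using ex[OF i(2)] closes_generate[OF S] k by blast
    qed
  qed (use mem in simp)
  then show ?thesis using mem by (auto simp: Ord_in_def pow_FZ)
qed

text \<open>Exports the coset graph on all prefixes of words in \<open>W\<close> without mentioning
  representatives. The last two facts prepare the pigeonhole argument: finitely many end states, and
  equal end states only within one coset.\<close>

lemma coset_automaton:
  assumes H: "subgroup H (FZ n m)" and W: "finite W" "W \<subseteq> words n"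
  obtains E where "inverse_automaton E" "\<And>w. w \<in> W \<Longrightarrow> run E 0 w \<noteq> None"
    "\<And>w c. w \<in> words n \<Longrightarrow> run E 0 w = Some (0, c) \<Longrightarrow> \<exists>b. (w, b) \<in> H \<and> c = - dot lam b"
    "\<And>w z c b. w \<in> words n \<Longrightarrow> run E 0 w = Some (z, c) \<Longrightarrow> (w, b) \<in> H \<Longrightarrow> z = 0"
    "finite {z. \<exists>w\<in>words n. \<exists>c. run E 0 w = Some (z, c)}"
    "\<And>w w' z c c'. w \<in> words n \<Longrightarrow> w' \<in> words n \<Longrightarrow> run E 0 w = Some (z, c) \<Longrightarrow>
       run E 0 w' = Some (z, c') \<Longrightarrow> \<exists>x b. (x, b) \<in> H \<and> w = fmult x w'"
proof -
  let ?V = "\<Union>w\<in>W. (\<lambda>i. take i w) ` {..length w}"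
  interpret coset_graph n m H lam ?V
    by (rule coset_graph.intro[OF H]) (use W in auto)
  show ?thesis
  proof (rule that[of edges])
    show "inverse_automaton edges" by (rule inverse_automaton_edges)
    show "run edges 0 w \<noteq> None" if w: "w \<in> W" for w
    proof (rule run_edges_defined)
      show "w \<in> words n" using w W by blast
      show "u \<in> ?V" if "w = u @ v" for u v
        using that w by (auto intro!: bexI[of _ w] image_eqI[of _ _ "length u"])
    qed
    show "\<exists>b. (w, b) \<in> H \<and> c = - dot lam b"
      if w: "w \<in> words n" and r: "run edges 0 w = Some (0, c)" for w c
    proof -
      from run_edges[OF w r] have "0 = word_code (rep w)" by blast
      then have "rep w = []" using word_code_eq_0[of "rep w"] by simp
      then show ?thesis using run_edges[OF w r] by (auto simp: related_Nil)
    qed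
    show "z = 0" if w: "w \<in> words n" and r: "run edges 0 w = Some (z, c)" and b: "(w, b) \<in> H" for w z c b
    proof -
      have "rep w = []" using rep_eq_Nil[OF w] b by blast
      then show ?thesis using run_edges[OF w r] word_code_eq_0[of "rep w"] by simp
    qed
    show "finite {z. \<exists>w\<in>words n. \<exists>c. run edges 0 w = Some (z, c)}"
    proof (rule finite_subset)
      show "{z. \<exists>w\<in>words n. \<exists>c. run edges 0 w = Some (z, c)} \<subseteq> insert 0 (word_code ` states)"
        using run_edges_states by blast
      show "finite (insert 0 (word_code ` states))" using finite_V by (simp add: states_def)
    qed
    show "\<exists>x b. (x, b) \<in> H \<and> w = fmult x w'"
      if w: "w \<in> words n" "w' \<in> words n" and r: "run edges 0 w = Some (z, c)" "run edges 0 w' = Some (z, c')"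
      for w w' z c c'
    proof -
      obtain b where b: "z = word_code (rep w)" "related b w (rep w)" using run_edges[OF w(1) r(1)] by blast
      obtain b' where b': "z = word_code (rep w')" "related b' w' (rep w')" using run_edges[OF w(2) r(2)] by blast
      have eq: "rep w' = rep w" using b(1) b'(1) by simp
      have "related (map uminus b') (rep w) w'"
        using related_sym[OF b'(2)] rep(1)[OF w(2)] eq by simp
      from related_trans[OF b(2) this w(2)] show ?thesis by (auto simp: related_def)
    qed
  qed
qed

lemma central_lattice:
  assumes H: "subgroup H (FZ n m)" shows "lattice m {l. ([], l) \<in> H}"
proof -
  note D = subgroup_FZ_D[OF H]
  have nat: "([], map ((*) (int k)) l) \<in> H" if l: "([], l) \<in> H" for k l
  proof -
    have "fst (elt_pow m ([], l) k) = []" by (induction k) (auto simp: elt_pow_0 elt_pow_Suc elt_mult_def)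
    moreover have "snd (elt_pow m ([], l) k) = map ((*) (int k)) l"
      using snd_elt_pow[of "([], l)" m k] D(2)[OF l] by simp
    ultimately show ?thesis using elt_pow_subgroup[OF H l, of k] by (metis prod.collapse)
  qed
  have int: "([], map ((*) p) l) \<in> H" if l: "([], l) \<in> H" for p l
  proof (cases p rule: int_cases2)
    case (nonneg k)
    then show ?thesis using nat[OF l] by simp
  next
    case (nonpos k)
    then have "map ((*) p) l = map uminus (map ((*) (int k)) l)" by simp
    then show ?thesis using D(5)[OF nat[OF l, of k]] by (simp only: inv_word_Nil)
  qed
  have "([], comb p q a b) \<in> H" if "([], a) \<in> H" "([], b) \<in> H" for p q a b
  proof -
    have "comb p q a b = map2 (+) (map ((*) p) a) (map ((*) q) b)"
      by (rule nth_equalityI) (auto simp: comb_def)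
    then show ?thesis using D(4)[OF int[OF that(1), of p] int[OF that(2), of q]] by simp
  qed
  then show ?thesis using D(2,3) by (auto simp: lattice_def)
qed

lemma subgroup_FZ_diff:
  assumes H: "subgroup H (FZ n m)" and a: "(w, a) \<in> H" and b: "(w, b) \<in> H"
  shows "([], map2 (+) (map uminus b) a) \<in> H"
proof -
  have "fmult (inv_word w) w = []"
    using fmult_inv_word_left[of "[]" w] words_reduced[OF subgroup_FZ_D(1)[OF H a]] by simp
  then show ?thesis using subgroup_FZ_D(4)[OF H subgroup_FZ_D(5)[OF H b] a] by simp
qed

text \<open>The weight of a generator's word matches the generator's vector only up to
  \<open>dot lam\<close> of a central vector of \<open>H\<close>; hypothesis \<open>N\<close>
  absorbs this ambiguity. Including \<open>w\<close> makes the word under investigation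
  readable.\<close>

lemma stabilises_coset_automaton:
  assumes S: "set S \<subseteq> carrier (FZ n m)" and w: "w \<in> words n"
    and N: "\<And>l. ([], l) \<in> generate (FZ n m) (set S) \<Longrightarrow> int N dvd dot lam l"
  obtains E where "stabilises (E, lam, N) S" "run E 0 w \<noteq> None"
    "\<And>c. run E 0 w = Some (0, c) \<Longrightarrow> \<exists>b. (w, b) \<in> generate (FZ n m) (set S) \<and> c = - dot lam b"
    "\<And>z c b. run E 0 w = Some (z, c) \<Longrightarrow> (w, b) \<in> generate (FZ n m) (set S) \<Longrightarrow> z = 0"
proof -
  let ?H = "generate (FZ n m) (set S)"
  have H: "subgroup ?H (FZ n m)" by (rule group.generate_is_subgroup[OF group_FZ S])
  have W: "finite (insert w (fst ` set S))" "insert w (fst ` set S) \<subseteq> words n"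
    using S w by (auto simp: carrier_FZ)
  obtain E where E: "inverse_automaton E" "\<And>v. v \<in> insert w (fst ` set S) \<Longrightarrow> run E 0 v \<noteq> None"
    "\<And>w c. w \<in> words n \<Longrightarrow> run E 0 w = Some (0, c) \<Longrightarrow> \<exists>b. (w, b) \<in> ?H \<and> c = - dot lam b"
    "\<And>w z c b. w \<in> words n \<Longrightarrow> run E 0 w = Some (z, c) \<Longrightarrow> (w, b) \<in> ?H \<Longrightarrow> z = 0"
    "finite {z. \<exists>w\<in>words n. \<exists>c. run E 0 w = Some (z, c)}"
    "\<And>w w' z c c'. w \<in> words n \<Longrightarrow> w' \<in> words n \<Longrightarrow> run E 0 w = Some (z, c) \<Longrightarrow>
       run E 0 w' = Some (z, c') \<Longrightarrow> \<exists>x b. (x, b) \<in> ?H \<and> w = fmult x w'"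
    by (rule coset_automaton[OF H W, of "lam"]) (rule that)
  have "closes (E, lam, N) s" if s: "s \<in> set S" for s
  proof -
    obtain v a where va: "s = (v, a)" by force
    have a: "(v, a) \<in> ?H" using s va generate.incl by metis
    have v: "v \<in> words n" by (rule subgroup_FZ_D(1)[OF H a])
    have "v \<in> insert w (fst ` set S)" using s va by force
    then obtain z c where r: "run E 0 v = Some (z, c)" using E(2)[of v] by auto
    have z: "z = 0" by (rule E(4)[OF v r a])
    then obtain b where b: "(v, b) \<in> ?H" "c = - dot lam b" using E(3)[OF v] r by blast
    have "int N dvd dot lam (map2 (+) (map uminus b) a)" by (rule N[OF subgroup_FZ_diff[OF H a b(1)]])
    moreover have "dot lam (map2 (+) (map uminus b) a) = c + dot lam a"
      using subgroup_FZ_D(2)[OF H a] subgroup_FZ_D(2)[OF H b(1)] b(2) by (simp add: dot_add dot_uminus)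
    ultimately show ?thesis using r z va by (simp add: closes_iff)
  qed
  then have "stabilises (E, lam, N) S" using E(1) by (simp add: stabilises_def)
  then show ?thesis
    by (rule that) (use E(2)[of w] E(3)[OF w] E(4)[OF w] in auto)
qed

lemma exclusion_complete:
  assumes S: "set S \<subseteq> carrier (FZ n m)" and h: "h \<in> carrier (FZ n m)"
    and notin: "h \<notin> generate (FZ n m) (set S)"
  obtains A where "stabilises A S" "\<not> closes A h"
proof -
  let ?H = "generate (FZ n m) (set S)"
  have H: "subgroup ?H (FZ n m)" by (rule group.generate_is_subgroup[OF group_FZ S])
  obtain w a where wa: "h = (w, a)" by force
  have w: "w \<in> words n" and a: "length a = m" using h wa by (auto simp: carrier_FZ)
  have "\<exists>lam N. (\<forall>l. ([], l) \<in> ?H \<longrightarrow> int N dvd dot lam l) \<and>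
      (\<forall>b. (w, b) \<in> ?H \<longrightarrow> \<not> int N dvd dot lam a - dot lam b)"
  proof (cases "\<exists>b. (w, b) \<in> ?H")
    case False
    \<comment> \<open>No vector accompanies \<open>w\<close>, so the condition on \<open>b\<close>
      is vacuous; the coset graph alone excludes \<open>h\<close>, as \<open>w\<close> does not
      return to the base state.\<close>
    then show ?thesis by (intro exI[of _ "[]"] exI[of _ 0]) auto
  next
    case True
    then obtain b where b: "(w, b) \<in> ?H" by blast
    have lb: "length b = m" by (rule subgroup_FZ_D(2)[OF H b])
    let ?d = "map2 (+) a (map uminus b)"
    have "([], ?d) \<notin> ?H"
    proof
      assume "([], ?d) \<in> ?H"
      from subgroup_FZ_D(4)[OF H this b] have "(w, map2 (+) ?d b) \<in> ?H" by simp
      moreover have "map2 (+) ?d b = a" using a lb by (auto intro!: nth_equalityI)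
      ultimately show False using notin wa by simp
    qed
    then obtain lam N where N: "\<And>l. ([], l) \<in> ?H \<Longrightarrow> int N dvd dot lam l" "\<not> int N dvd dot lam ?d"
      using separate_from_lattice[OF central_lattice[OF H], of ?d] a lb by auto
    \<comment> \<open>The automaton may produce another vector for \<open>w\<close> than
      \<open>b\<close>. Two such vectors differ by a central vector of \<open>H\<close>, on which
      \<open>lam\<close> is 0 modulo \<open>N\<close>.\<close>
    have "\<not> int N dvd dot lam a - dot lam b'" if b': "(w, b') \<in> ?H" for b'
    proof
      assume dv: "int N dvd dot lam a - dot lam b'"
      have "int N dvd dot lam (map2 (+) (map uminus b) b')" by (rule N(1)[OF subgroup_FZ_diff[OF H b' b]])
      then have "int N dvd dot lam b' - dot lam b"
        using lb subgroup_FZ_D(2)[OF H b'] by (simp add: dot_add dot_uminus)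
      from dvd_add[OF dv this] have "int N dvd dot lam a - dot lam b" by simp
      then show False using N(2) a lb by (simp add: dot_add dot_uminus)
    qed
    then show ?thesis using N(1) by blast
  qed
  then obtain lam N where N: "\<And>l. ([], l) \<in> ?H \<Longrightarrow> int N dvd dot lam l"
    "\<And>b. (w, b) \<in> ?H \<Longrightarrow> \<not> int N dvd dot lam a - dot lam b" by blast
  obtain E where E: "stabilises (E, lam, N) S" "run E 0 w \<noteq> None"
    "\<And>c. run E 0 w = Some (0, c) \<Longrightarrow> \<exists>b. (w, b) \<in> ?H \<and> c = - dot lam b"
    "\<And>z c b. run E 0 w = Some (z, c) \<Longrightarrow> (w, b) \<in> ?H \<Longrightarrow> z = 0"
    by (rule stabilises_coset_automaton[OF S w N(1)]) (assumption, rule that)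
  have "\<not> closes (E, lam, N) h"
  proof
    assume "closes (E, lam, N) h"
    then obtain c where c: "run E 0 w = Some (0, c)" "int N dvd c + dot lam a" by (auto simp: wa closes_iff)
    obtain b where b: "(w, b) \<in> ?H" "c = - dot lam b" using E(3)[OF c(1)] by blast
    then show False using N(2)[OF b(1)] c(2) by (simp add: algebra_simps)
  qed
  with E(1) show ?thesis by (rule that)
qed

lemma drift_cert_complete:
  assumes S: "set S \<subseteq> carrier (FZ n m)" and g: "g \<in> carrier (FZ n m)"
    and b: "(fst (elt_pow m g (Suc k)), b) \<in> generate (FZ n m) (set S)"
    and notin: "\<And>i. 1 \<le> i \<Longrightarrow> elt_pow m g i \<notin> generate (FZ n m) (set S)"
  shows "\<exists>A. drift_cert m S g A k"
proof -
  let ?H = "generate (FZ n m) (set S)"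
  let ?h = "elt_pow m g (Suc k)"
  let ?w = "fst ?h" and ?a = "snd ?h"
  have H: "subgroup ?H (FZ n m)" by (rule group.generate_is_subgroup[OF group_FZ S])
  have h: "?h \<in> carrier (FZ n m)" by (rule elt_pow_carrier[OF g])
  then have w: "?w \<in> words n" and a: "length ?a = m" by (simp_all only: carrier_FZ mem_Collect_eq)
  have lb: "length b = m" by (rule subgroup_FZ_D(2)[OF H b])
  define d where "d = map2 (+) ?a (map uminus b)"
  have ld: "length d = m" using a lb by (simp add: d_def)
  \<comment> \<open>If \<open>q\<close> times \<open>d\<close> were central in \<open>H\<close>,
    adding \<open>q\<close> times \<open>b\<close> would give the vector of the \<open>q\<close>-th
    power of \<open>elt_pow m g (Suc k)\<close> and place that power in \<open>H\<close>.\<close>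
  have no: "map ((*) q) d \<notin> {l. ([], l) \<in> ?H}" if q: "0 < q" for q
  proof
    assume "map ((*) q) d \<in> {l. ([], l) \<in> ?H}"
    then have qd: "([], map ((*) (int (nat q))) d) \<in> ?H" using q by simp
    have "elt_pow m (?w, b) (nat q) \<in> ?H" by (rule elt_pow_subgroup[OF H b])
    moreover have "snd (elt_pow m (?w, b) (nat q)) = map ((*) (int (nat q))) b"
      using snd_elt_pow[of "(?w, b)" m] lb by simp
    moreover have "fst (elt_pow m (?w, b) (nat q)) = fst (elt_pow m ?h (nat q))"
      by (rule fst_elt_pow_cong) simp
    ultimately have "(fst (elt_pow m ?h (nat q)), map ((*) (int (nat q))) b) \<in> ?H"
      by (metis prod.collapse)
    from subgroup_FZ_D(4)[OF H qd this]
    have "(fst (elt_pow m ?h (nat q)), map2 (+) (map ((*) (int (nat q))) d) (map ((*) (int (nat q))) b)) \<in> ?H"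
      by simp
    moreover have "map2 (+) (map ((*) (int (nat q))) d) (map ((*) (int (nat q))) b) = snd (elt_pow m ?h (nat q))"
      using a lb by (subst snd_elt_pow) (auto simp: d_def algebra_simps intro!: nth_equalityI)
    ultimately have "elt_pow m ?h (nat q) \<in> ?H" by simp
    then have "elt_pow m g (Suc k * nat q) \<in> ?H" by (simp only: elt_pow_mult[OF g])
    moreover have "1 \<le> Suc k * nat q" using q by (cases "nat q") auto
    ultimately show False using notin by blast
  qed
  obtain lam where lam: "\<And>l. ([], l) \<in> ?H \<Longrightarrow> dot lam l = 0" "dot lam d \<noteq> 0"
    using annihilate_lattice[OF central_lattice[OF H] ld no] by auto
  have dvd: "int 0 dvd dot lam l" if "([], l) \<in> ?H" for l using lam(1)[OF that] by simp
  obtain E where E: "stabilises (E, lam, 0) S" "run E 0 ?w \<noteq> None"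
    "\<And>c. run E 0 ?w = Some (0, c) \<Longrightarrow> \<exists>b. (?w, b) \<in> ?H \<and> c = - dot lam b"
    "\<And>z c b. run E 0 ?w = Some (z, c) \<Longrightarrow> (?w, b) \<in> ?H \<Longrightarrow> z = 0"
    by (rule stabilises_coset_automaton[OF S w dvd]) (assumption, rule that)
  obtain c where c: "run E 0 ?w = Some (0, c)" using E(2) E(4)[OF _ b] by auto
  obtain b' where b': "(?w, b') \<in> ?H" "c = - dot lam b'" using E(3)[OF c] by blast
  have "dot lam (map2 (+) (map uminus b') b) = 0" by (rule lam(1)[OF subgroup_FZ_diff[OF H b b'(1)]])
  then have "dot lam b' = dot lam b"
    using lb subgroup_FZ_D(2)[OF H b'(1)] by (simp add: dot_add dot_uminus)
  then have "c + dot lam ?a = dot lam d" using b'(2) a lb by (simp add: d_def dot_add dot_uminus)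
  then have "closes (E, lam, 1) (?w, ?a)" "\<not> closes (E, lam, 0) (?w, ?a)"
    using c lam(2) unfolding closes_iff by auto
  then have "closes (E, lam, 1) ?h" "\<not> closes (E, lam, 0) ?h" by simp_all
  then show ?thesis using E(1) by (intro exI[of _ "(E, lam, 0)"]) (simp add: drift_cert_def)
qed

text \<open>Mutually inverse end letters are stripped as long as there are any. The core cannot
  become empty, because a reduced word has no adjacent inverse pair.\<close>

lemma conjugate_decomposition:
  "reduced u \<Longrightarrow> u \<noteq> [] \<Longrightarrow> \<exists>c v. u = c @ v @ inv_word c \<and> v \<noteq> [] \<and> reduced (v @ v)"
proof (induction u rule: length_induct)
  case (1 u)
  show ?case
  proof (cases "hd u = flip (last u)")
    case False
    then show ?thesis using 1 by (intro exI[of _ "[]"] exI[of _ u]) (auto simp: reduced_append_iff)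
  next
    case True
    have ne: "flip x \<noteq> x" for x by (simp add: flip_def prod_eq_iff)
    obtain x t where x: "u = x # t" using 1 by (cases u) auto
    have t: "t \<noteq> []" using True x ne[of x] by auto
    then obtain v y where y: "t = v @ [y]" by (cases t rule: rev_cases) auto
    have xy: "y = flip x" using True x y by auto
    have u: "u = [x] @ v @ [flip x]" using x y xy by simp
    have "v \<noteq> []" using 1(2) u by (auto simp: reduced_Cons)
    moreover have "reduced v" using 1(2) unfolding u reduced_append_iff by blast
    ultimately obtain c z where "v = c @ z @ inv_word c" "z \<noteq> []" "reduced (z @ z)"
      using 1(1)[rule_format, of v] u by auto
    then show ?thesis using u by (intro exI[of _ "x # c"] exI[of _ z]) (simp add: inv_word_Cons)
  qed
qed

lemma unreadable_cert_complete:
  assumes S: "set S \<subseteq> carrier (FZ n m)" and g: "g \<in> carrier (FZ n m)"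
    and notin: "\<And>k b. (fst (elt_pow m g (Suc k)), b) \<notin> generate (FZ n m) (set S)"
  shows "\<exists>A c v j. unreadable_cert S g A c v j"
proof -
  let ?H = "generate (FZ n m) (set S)"
  have H: "subgroup ?H (FZ n m)" by (rule group.generate_is_subgroup[OF group_FZ S])
  have gw: "fst g \<in> words n" using g by (simp add: carrier_FZ)
  have g1: "fst (elt_pow m g (Suc 0)) = fst g" using elt_pow_1[OF g] by simp
  have "fst g \<noteq> []"
  proof
    assume "fst g = []"
    then show False using notin[of 0 "replicate m 0"] subgroup_FZ_D(3)[OF H] g1 by simp
  qed
  then obtain c v where cv: "fst g = c @ v @ inv_word c" "v \<noteq> []" "reduced (v @ v)"
    using conjugate_decomposition[OF words_reduced[OF gw]] by blast
  have red: "reduced (c @ v @ v @ inv_word c)"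
    using words_reduced[OF gw] cv by (auto simp: reduced_append_iff)
  have pw: "fst (elt_pow m g (Suc k)) = power_word c v (Suc k) @ inv_word c" for k
    by (rule fst_elt_pow_conjugate[OF red cv(2,1)])
  have words_pw: "power_word c v k \<in> words n" for k
  proof -
    have "power_word c v (Suc k) @ inv_word c \<in> words n"
      using elt_pow_carrier[OF g, of "Suc k"] pw[of k] unfolding carrier_FZ by simp
    then show ?thesis using words_appendD(1)[of "power_word c v k"] by simp
  qed
  have sq: "fmult (fst g) (fst g) = c @ v @ v @ inv_word c"
    using pw[of 1] g1 by (simp add: elt_pow_Suc elt_mult_def)
  have W: "finite (fst ` set S)" "fst ` set S \<subseteq> words n" using S by (auto simp: carrier_FZ)
  obtain E where E: "inverse_automaton E" "\<And>v. v \<in> fst ` set S \<Longrightarrow> run E 0 v \<noteq> None"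
    "\<And>w c. w \<in> words n \<Longrightarrow> run E 0 w = Some (0, c) \<Longrightarrow> \<exists>b. (w, b) \<in> ?H \<and> c = - dot [] b"
    "\<And>w z c b. w \<in> words n \<Longrightarrow> run E 0 w = Some (z, c) \<Longrightarrow> (w, b) \<in> ?H \<Longrightarrow> z = 0"
    "finite {z. \<exists>w\<in>words n. \<exists>c. run E 0 w = Some (z, c)}"
    "\<And>w w' z c c'. w \<in> words n \<Longrightarrow> w' \<in> words n \<Longrightarrow> run E 0 w = Some (z, c) \<Longrightarrow>
       run E 0 w' = Some (z, c') \<Longrightarrow> \<exists>x b. (x, b) \<in> ?H \<and> w = fmult x w'"
    by (rule coset_automaton[OF H W, of "[]"]) (rule that)
  \<comment> \<open>Only the free part matters here: the zero functional and modulus 1 reduce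
    \<open>closes\<close> to the return to the base state.\<close>
  have "closes (E, [], 1) s" if s: "s \<in> set S" for s
  proof -
    obtain w a where wa: "s = (w, a)" by force
    have a: "(w, a) \<in> ?H" using s wa generate.incl by metis
    obtain z e where r: "run E 0 w = Some (z, e)" using E(2)[of w] s wa by force
    have "z = 0" by (rule E(4)[OF subgroup_FZ_D(1)[OF H a] r a])
    then show ?thesis using r wa by (simp add: closes_iff)
  qed
  then have st: "stabilises (E, [], 1) S" using E(1) by (simp add: stabilises_def)
  have "\<exists>j. run E 0 (power_word c v j) = None"
  proof (rule ccontr)
    assume "\<not> ?thesis"
    then have f0: "run E 0 (power_word c v j) \<noteq> None" for j by simp
    define f where "f j = the (run E 0 (power_word c v j))" for j
    have f: "run E 0 (power_word c v j) = Some (f j)" for j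
      using f0[of j] by (simp add: f_def)
    have "range (\<lambda>j. fst (f j)) \<subseteq> {z. \<exists>w\<in>words n. \<exists>c. run E 0 w = Some (z, c)}"
    proof
      fix z assume "z \<in> range (\<lambda>j. fst (f j))"
      then obtain j where "z = fst (f j)" by blast
      then have "run E 0 (power_word c v j) = Some (z, snd (f j))" using f by simp
      then show "z \<in> {z. \<exists>w\<in>words n. \<exists>c. run E 0 w = Some (z, c)}" using words_pw by blast
    qed
    then have "finite (range (\<lambda>j. fst (f j)))" using E(5) by (rule finite_subset)
    then have "\<not> inj (\<lambda>j. fst (f j))" using finite_imageD[of "\<lambda>j. fst (f j)" UNIV] by auto
    then obtain i j where "fst (f i) = fst (f j)" "i \<noteq> j" by (auto simp: inj_def)
    then obtain i k where ik: "fst (f (Suc k + i)) = fst (f i)"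
    proof (cases "i < j")
      case True
      then obtain k where "j = Suc k + i" using less_imp_Suc_add[of i j] by (auto simp: add.commute)
      then show ?thesis using that[of k i] \<open>fst (f i) = fst (f j)\<close> by simp
    next
      case False
      then obtain k where "i = Suc k + j"
        using \<open>i \<noteq> j\<close> less_imp_Suc_add[of j i] by (auto simp: add.commute)
      then show ?thesis using that[of k j] \<open>fst (f i) = fst (f j)\<close> by simp
    qed
    let ?u = "fst (elt_pow m g (Suc k))"
    have r1: "run E 0 (power_word c v (Suc k + i)) = Some (fst (f i), snd (f (Suc k + i)))"
      using f[of "Suc k + i"] ik by (simp only: prod.collapse flip: ik)
    have r2: "run E 0 (power_word c v i) = Some (fst (f i), snd (f i))" using f[of i] by simp
    \<comment> \<open>Equal end states mean equal cosets. Cancelling \<open>power_word c v i\<close>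
      on the right then identifies \<open>x\<close> with the word of the power with exponent
      \<open>Suc k\<close>, which contradicts \<open>notin\<close>.\<close>
    obtain x b where x: "(x, b) \<in> ?H" "power_word c v (Suc k + i) = fmult x (power_word c v i)"
      using E(6)[OF words_pw words_pw r1 r2] by blast
    have ri: "reduced (power_word c v i)" and rki: "reduced (power_word c v (Suc k + i))"
      by (rule words_reduced[OF words_pw])+
    have app: "power_word c v (Suc k + i) = power_word c v (Suc k) @ power_word [] v i"
      by (rule power_word_add)
    have "reduced (power_word [] v i)" using rki unfolding app by (simp add: reduced_append_iff)
    from fmult_inv_word_left[OF this, of c]
    have "fmult (inv_word c) (c @ power_word [] v i) = power_word [] v i"
      using ri by (simp only: fmult_eq_append power_word_append[of c v i])
    then have "fmult (inv_word c) (power_word c v i) = power_word [] v i"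
      by (simp only: power_word_append[of c v i])
    then have "fmult ?u (power_word c v i) = fmult (power_word c v (Suc k)) (power_word [] v i)"
      by (simp only: pw[of k] fmult_append)
    also have "\<dots> = power_word c v (Suc k) @ power_word [] v i"
      using rki unfolding app by (rule fmult_eq_append)
    also have "\<dots> = fmult x (power_word c v i)" using x(2) app by (simp only:)
    finally have eq: "fmult ?u (power_word c v i) = fmult x (power_word c v i)" .
    have cancel: "fmult (fmult y (power_word c v i)) (inv_word (power_word c v i)) = y"
      if "reduced y" for y
    proof -
      have r: "reduced (inv_word (power_word c v i))" by (rule reduced_inv_word[OF ri])
      have "fmult (power_word c v i) (inv_word (power_word c v i)) = []"
        using fmult_inv_word_right[of "[]" "power_word c v i"] r by simp
      then show ?thesis using that by (simp only: fmult_assoc[OF r] fmult_Nil2)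
    qed
    have u: "reduced ?u" unfolding pw by (rule reduced_power_word(1)[OF red cv(2)])
    have "?u = fmult (fmult ?u (power_word c v i)) (inv_word (power_word c v i))"
      by (rule cancel[OF u, symmetric])
    also have "\<dots> = x"
      unfolding eq by (rule cancel[OF words_reduced[OF subgroup_FZ_D(1)[OF H x(1)]]])
    finally have "?u = x" .
    then show False using notin x(1) by blast
  qed
  then obtain j where "run E 0 (power_word c v j) = None" by blast
  then have "unreadable_cert S g (E, [], 1) c v j"
    using st cv(1,2) sq by (simp add: unreadable_cert_def)
  then show ?thesis by blast
qed

lemma order_cert_complete:
  assumes S: "set S \<subseteq> carrier (FZ n m)" and g: "g \<in> carrier (FZ n m)"
    and k: "1 \<le> k" "elt_pow m g k \<in> generate (FZ n m) (set S)"
  shows "\<exists>T As. order_cert m S g T As"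
proof -
  let ?H = "generate (FZ n m) (set S)"
  define P where "P = (\<lambda>k. 1 \<le> k \<and> elt_pow m g k \<in> ?H)"
  have P: "P (LEAST k. P k)" by (rule LeastI[of P k]) (use k in \<open>simp add: P_def\<close>)
  then obtain l where l: "(LEAST k. P k) = Suc l" by (cases "LEAST k. P k") (auto simp: P_def)
  have "\<exists>A. stabilises A S \<and> \<not> closes A (elt_pow m g (Suc i))" if "i < l" for i
  proof -
    have "\<not> P (Suc i)" using that l not_less_Least[of "Suc i" P] by simp
    then have "elt_pow m g (Suc i) \<notin> ?H" by (simp add: P_def)
    from exclusion_complete[OF S elt_pow_carrier[OF g] this] show ?thesis by blast
  qed
  then obtain A where A: "\<And>i. i < l \<Longrightarrow> stabilises (A i) S \<and> \<not> closes (A i) (elt_pow m g (Suc i))"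
    by metis
  have "elt_pow m g (Suc (length (map A [0..<l]))) \<in> ?H" using P l by (simp add: P_def)
  moreover have "\<forall>i<length (map A [0..<l]). stabilises (map A [0..<l] ! i) S \<and>
      \<not> closes (map A [0..<l] ! i) (elt_pow m g (Suc i))" using A by simp
  ultimately show ?thesis using order_cert_iff[OF S, of g "map A [0..<l]"] by blast
qed

section \<open>Computability of the certificate check\<close>

lemma computable_flip: "computable f \<Longrightarrow> computable (\<lambda>x. flip (f x))"
  unfolding flip_def by (intro computable_intros)

lemma computable_push:
  assumes "computable f" "computable g" shows "computable (\<lambda>x. push (f x) (g x))"
proof (rule computable_compose2[OF _ assms])
  have "push x w = (case w of [] \<Rightarrow> [x] | y # ys \<Rightarrow> if y = flip x then ys else x # y # ys)" for x w
    by (cases w) (simp_all only: push_Nil push_Cons list.case)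
  then show "computable (\<lambda>p. push (fst p) (snd p))"
    by (simp only:) (intro computable_intros computable_flip)
qed

lemma computable_fmult:
  assumes "computable f" "computable g" shows "computable (\<lambda>x. fmult (f x) (g x))"
proof (rule computable_compose2[OF _ assms])
  show "computable (\<lambda>p. fmult (fst p) (snd p))"
    unfolding fmult_def foldr_conv_foldl by (intro computable_intros computable_push)
qed

lemma computable_inv_word: "computable f \<Longrightarrow> computable (\<lambda>x. inv_word (f x))"
  unfolding inv_word_def by (intro computable_intros computable_flip)

lemma computable_elt_mult:
  assumes "computable f" "computable g" shows "computable (\<lambda>x. elt_mult (f x) (g x))"
  unfolding elt_mult_def case_prod_beta
  by (intro computable_intros computable_fmult assms)

lemma computable_elt_inv: "computable f \<Longrightarrow> computable (\<lambda>x. elt_inv (f x))"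
  unfolding elt_inv_def by (intro computable_intros computable_inv_word)

lemma computable_elt_pow:
  assumes "computable f" "computable k" shows "computable (\<lambda>x. elt_pow m (f x) (k x))"
proof (rule computable_compose2[OF _ assms])
  show "computable (\<lambda>p. elt_pow m (fst p) (snd p))"
    unfolding elt_pow_def by (intro computable_intros computable_elt_mult)
qed

lemma computable_power_word:
  assumes "computable f" "computable g" "computable k"
  shows "computable (\<lambda>x. power_word (f x) (g x) (k x))"
proof (rule computable_compose3[OF _ assms])
  show "computable (\<lambda>p. power_word (fst p) (fst (snd p)) (snd (snd p)))"
    unfolding power_word_def by (intro computable_intros)
qed

lemma computable_lookup:
  assumes "computable f" "computable g" "computable h"
  shows "computable (\<lambda>x. lookup (f x) (g x) (h x))"
proof (rule computable_compose3[OF _ assms])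
  show "computable (\<lambda>p. lookup (fst p) (fst (snd p)) (snd (snd p)))"
    unfolding lookup_def edge_step_def by (intro computable_intros)
qed

lemma computable_run:
  assumes "computable f" "computable g" "computable h"
  shows "computable (\<lambda>x. run (f x) (g x) (h x))"
proof (rule computable_compose3[OF _ assms])
  show "computable (\<lambda>p. run (fst p) (fst (snd p)) (snd (snd p)))"
    unfolding run_def run_step_def by (intro computable_intros computable_lookup)
qed

lemma computable_inverse_automaton: "computable f \<Longrightarrow> computable (\<lambda>x. inverse_automaton (f x))"
  unfolding inverse_automaton_def
  by (rule computable_compose[where f = "\<lambda>E. \<forall>e\<in>set E. P E e" for P])
    (intro computable_intros computable_lookup)

lemma computable_dot:
  assumes "computable f" "computable g" shows "computable (\<lambda>x. dot (f x) (g x))"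
  unfolding dot_def by (intro computable_intros assms)

lemma computable_closes:
  assumes "computable f" "computable g" shows "computable (\<lambda>x. closes (f x) (g x))"
proof (rule computable_compose2[OF _ assms])
  show "computable (\<lambda>p. closes (fst p) (snd p))"
    unfolding closes_def by (intro computable_intros computable_run computable_dot)
qed

lemma computable_stabilises:
  assumes "computable f" "computable g" shows "computable (\<lambda>x. stabilises (f x) (g x))"
proof (rule computable_compose2[OF _ assms])
  show "computable (\<lambda>p. stabilises (fst p) (snd p))"
    unfolding stabilises_def
    by (intro computable_intros computable_inverse_automaton computable_closes)
qed

lemma computable_unreadable_cert:
  assumes "computable S" "computable g" "computable A" "computable c" "computable v" "computable j"
  shows "computable (\<lambda>x. unreadable_cert (S x) (g x) (A x) (c x) (v x) (j x))"
  unfolding unreadable_cert_def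
  by (intro computable_intros computable_stabilises computable_fmult computable_inv_word
      computable_run computable_power_word assms)

lemma computable_drift_cert:
  assumes "computable S" "computable g" "computable A" "computable k"
  shows "computable (\<lambda>x. drift_cert m (S x) (g x) (A x) (k x))"
  unfolding drift_cert_def
  by (intro computable_intros computable_stabilises computable_closes computable_elt_pow assms)

lemma computable_order_cert:
  assumes "computable S" "computable g" "computable T" "computable As"
  shows "computable (\<lambda>x. order_cert m (S x) (g x) (T x) (As x))"
  unfolding order_cert_def exclude_step_def
  by (intro computable_intros computable_stabilises computable_closes computable_elt_pow
      computable_elt_mult computable_elt_inv computable_compose[OF assms(1)]
      computable_compose[OF assms(2)] assms)

section \<open>Codes of inputs and certificates\<close>

definition letter_of_code :: "nat \<Rightarrow> letter" where
  "letter_of_code k = (k div 2, odd k)"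

definition elt_of_code :: "nat list \<times> int list \<Rightarrow> letter list \<times> int list" where
  "elt_of_code r = (map letter_of_code (fst r), snd r)"

text \<open>With letters kept as numbers, the generic \<open>encode\<close> reproduces the coding
  \<open>enc_elt\<close> used in the theorem.\<close>

definition code_of_elt :: "letter list \<times> int list \<Rightarrow> nat list \<times> int list" where
  "code_of_elt g = (map enc_letter (fst g), snd g)"

lemma letter_of_code_enc_letter [simp]: "letter_of_code (enc_letter x) = x"
  by (auto simp: letter_of_code_def enc_letter_def prod_eq_iff)

lemma elt_of_code_code_of_elt [simp]: "elt_of_code (code_of_elt g) = g"
  by (simp add: elt_of_code_def code_of_elt_def o_def)

lemma encode_nat_list: "encode (xs :: nat list) = list_encode xs"
  by (simp add: encode_list_def encode_nat_def[abs_def])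

lemma encode_code_of_elt: "encode (code_of_elt g) = enc_elt g"
  by (simp add: code_of_elt_def enc_elt_def encode_prod_def encode_nat_list)
    (simp add: encode_list_def encode_int_def[abs_def])

lemma encode_input: "encode (map code_of_elt S, code_of_elt g) = enc_input S g"
  by (simp add: enc_input_def encode_simps(1) encode_code_of_elt encode_list_def o_def)

lemma computable_letters:
  "computable f \<Longrightarrow> computable (\<lambda>x. map letter_of_code (f x))"
  unfolding letter_of_code_def by (intro computable_intros)

lemma computable_elt_of_code: "computable f \<Longrightarrow> computable (\<lambda>x. elt_of_code (f x))"
  unfolding elt_of_code_def by (intro computable_intros computable_letters)

type_synonym certificate =
  "nat \<times> (weighted_automaton \<times> nat list \<times> nat list \<times> nat) \<times>
    (nat list \<times> int list) list \<times> weighted_automaton list"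

text \<open>The first component selects the kind of certificate. Words in a certificate are given by the
  codes of their letters, so that every natural number is the code of a certificate.\<close>

definition accepts :: "nat \<Rightarrow> (letter list \<times> int list) list \<Rightarrow> letter list \<times> int list \<Rightarrow> certificate \<Rightarrow> bool" where
  "accepts m S g C =
    (if fst C = 0 then unreadable_cert S g (fst (fst (snd C)))
        (map letter_of_code (fst (snd (fst (snd C)))))
        (map letter_of_code (fst (snd (snd (fst (snd C)))))) (snd (snd (snd (fst (snd C)))))
     else if fst C = 1 then drift_cert m S g (fst (fst (snd C))) (snd (snd (snd (fst (snd C)))))
     else order_cert m S g (map elt_of_code (fst (snd (snd C)))) (snd (snd (snd C))))"

text \<open>The length counts the excluded exponents, which start at 1, so the order is one more;
  infinite order gives 0 by the convention of \<open>Ord_in\<close>.\<close>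

definition result :: "certificate \<Rightarrow> nat" where
  "result C = (if fst C \<le> 1 then 0 else Suc (length (snd (snd (snd C)))))"

lemma computable_accepts:
  assumes "computable S" "computable g" "computable C"
  shows "computable (\<lambda>x. accepts m (S x) (g x) (C x))"
  unfolding accepts_def
  by (intro computable_intros computable_unreadable_cert computable_drift_cert computable_order_cert
      computable_letters computable_elt_of_code assms)

lemma computable_result: "computable result"
  unfolding result_def by (intro computable_intros)

lemma accepts_sound:
  assumes S: "set S \<subseteq> carrier (FZ n m)" and g: "g \<in> carrier (FZ n m)" and acc: "accepts m S g C"
  shows "Ord_in (FZ n m) (generate (FZ n m) (set S)) g = result C"
proof -
  consider "fst C = 0" | "fst C = 1" | "1 < fst C" by linarith
  then show ?thesis
  proof cases
    case 1
    obtain A c v j where "unreadable_cert S g A c v j"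
      using acc unfolding accepts_def if_P[OF 1] by blast
    then have "Ord_in (FZ n m) (generate (FZ n m) (set S)) g = 0"
      by (intro Ord_in_eq_0 unreadable_cert_sound[OF S g])
    then show ?thesis using 1 by (simp add: result_def)
  next
    case 2
    obtain A k where "drift_cert m S g A k"
      using acc 2 by (simp add: accepts_def)
    then have "Ord_in (FZ n m) (generate (FZ n m) (set S)) g = 0"
      by (intro Ord_in_eq_0 drift_cert_sound[OF S g])
    then show ?thesis using 2 by (simp add: result_def)
  next
    case 3
    then have "order_cert m S g (map elt_of_code (fst (snd (snd C)))) (snd (snd (snd C)))"
      using acc by (simp add: accepts_def split: if_splits)
    from order_cert_sound[OF S this] show ?thesis using 3 by (simp add: result_def)
  qed
qed

lemma accepts_complete:
  assumes S: "set S \<subseteq> carrier (FZ n m)" and g: "g \<in> carrier (FZ n m)"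
  shows "\<exists>C. accepts m S g C"
proof -
  let ?H = "generate (FZ n m) (set S)"
  consider (finite) k where "1 \<le> k" "elt_pow m g k \<in> ?H"
    | (drift) k b where "\<And>i. 1 \<le> i \<Longrightarrow> elt_pow m g i \<notin> ?H" "(fst (elt_pow m g (Suc k)), b) \<in> ?H"
    | (unreadable) "\<And>k b. (fst (elt_pow m g (Suc k)), b) \<notin> ?H"
    by blast
  then show ?thesis
  proof cases
    case finite
    obtain T As where "order_cert m S g T As" using order_cert_complete[OF S g finite] by blast
    then have "accepts m S g (2, ((([], [], 0), [], [], 0), map code_of_elt T, As))"
      by (simp add: accepts_def o_def)
    then show ?thesis by blast
  next
    case drift
    obtain A where "drift_cert m S g A k" using drift_cert_complete[OF S g drift(2,1)] by blast
    then have "accepts m S g (1, ((A, [], [], k), [], []))" by (simp add: accepts_def)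
    then show ?thesis by blast
  next
    case unreadable
    obtain A c v j where "unreadable_cert S g A c v j"
      using unreadable_cert_complete[OF S g unreadable] by blast
    then have "accepts m S g (0, ((A, map enc_letter c, map enc_letter v, j), [], []))"
      by (simp add: accepts_def o_def)
    then show ?thesis by blast
  qed
qed

theorem theorem7p23:
  fixes n m :: nat
  shows "\<exists>r. \<forall>S g. set S \<subseteq> carrier (FZ n m) \<longrightarrow> g \<in> carrier (FZ n m) \<longrightarrow>
           reval r [enc_input S g] (Ord_in (FZ n m) (generate (FZ n m) (set S)) g)"
proof -
  define P where "P x C = accepts m (map elt_of_code (fst x)) (elt_of_code (snd x)) C"
    for x :: "(nat list \<times> int list) list \<times> nat list \<times> int list" and C
  have "computable (\<lambda>p. P (fst p) (snd p))"
    unfolding P_def by (intro computable_intros computable_accepts computable_elt_of_code)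
  from computable_search[OF this computable_result]
  obtain r where r: "\<And>x. \<exists>C. P x C \<Longrightarrow> \<exists>C. P x C \<and> reval r [encode x] (result C)" by blast
  have "reval r [enc_input S g] (Ord_in (FZ n m) (generate (FZ n m) (set S)) g)"
    if S: "set S \<subseteq> carrier (FZ n m)" and g: "g \<in> carrier (FZ n m)" for S g
  proof -
    have P: "P (map code_of_elt S, code_of_elt g) C \<longleftrightarrow> accepts m S g C" for C
      by (simp add: P_def o_def)
    \<comment> \<open>Completeness only ensures that the search halts. It may stop at another
      certificate, whose result soundness identifies with the order.\<close>
    obtain C where "accepts m S g C" "reval r [enc_input S g] (result C)"
      using r[of "(map code_of_elt S, code_of_elt g)"] accepts_complete[OF S g]
      unfolding P encode_input by blast
    then show ?thesis using accepts_sound[OF S g] by simp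
  qed
  then show ?thesis by blast
qed

end
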